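(* Let $\nu,\beta\in]0,+\infty[$, let $\mu$ be a positive Radon measure on $E$, $p\in[1,+\infty[$ and $\eta\in]0,\nu]$. Let $\mathbf X$ be the Hunt process on $E$ with semigroup kernel $p_t(x,y)$ described in the context, and suppose that the Bishop type inequality and the upper and lower heat kernel estimates described in the context hold. (1) If there exist constants $r_0,C_2>0$ such that $\mu(B_r(x))\le C_2r^\eta$ for any $x\in E$ and $r\in]0,r_0]$, and $\eta-p(\nu-\beta)>0$ holds, then $\mu\in K_{\nu,\beta}^{\,p}$. (2) If there exist $x_0\in E$ and constants $r_0,C_1>0$ such that $C_1r^\eta\le\mu(B_r(x_0))$ for any $r\in]0,r_0]$, and $\mu\in D_{\nu,\beta}^{\,p}$ holds, then $\eta-p(\nu-\beta)\ge0$. (3) If there exist $x_0\in E$ and constants $r_0,C_1,C_2>0$ such that $C_1r^\eta\le\mu(B_r(x_0))\le C_2r^\eta$ for any $r\in]0,r_0]$, and $\mu\in D_{\nu,\beta}^{\,p}$ holds, then $\eta-p(\nu-\beta)>0$. In particular, if $\mu$ satisfies the Ahlfors regularity, i.e. $C_1r^\eta\le\mu(B_r(x))\le C_2r^\eta$ for all $x\in E$ and $r\in]0,r_0]$ with some $r_0,C_1,C_2>0$, then the following are equivalent: (a) $\mu\in K_{\nu,\beta}^{\,p}$; (b) $\mu\in D_{\nu,\beta}^{\,p}$; (c) $\eta-p(\nu-\beta)>0$.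
   Context: Notation: $]a,b[$ denotes an open interval, $a\lor b=\max\{a,b\}$; "increasing" and "decreasing" are in the wide (non-strict) sense. Setting. $(E,d)$ is a locally compact separable metric space, $\mathfrak m$ is a positive Radon measure on $E$ with full support, $B_r(x)=\{y\in E: d(x,y)<r\}$. $(\mathscr E,\mathscr F)$ is a symmetric regular Dirichlet form on $L^2(E;\mathfrak m)$, and $\mathbf X=(\Omega,X_t,\zeta,\mathbf P_x)$ is an associated Hunt process. It is assumed that there is a jointly measurable nonnegative function $p_t(x,y)$, $(t,x,y)\in]0,+\infty[\times E\times E$ (semigroup kernel, or heat kernel) with $\mathbf E_x[u(X_t)]=\int_E p_t(x,y)u(y)\,\mathfrak m(dy)$ for all $x\in E$, $t>0$ and bounded Borel $u$; moreover $p_{t+s}(x,y)=\int_E p_s(x,z)p_t(z,y)\,\mathfrak m(dz)$ for all $x,y\in E$, $s,t>0$, and $\int_E p_t(x,y)\,\mathfrak m(dy)\le 1$. Assumptions. Fix $\nu,\beta\in]0,+\infty[$, $t_0\in]0,+\infty]$, and an increasing positive function $V$ on $]0,+\infty[$. - Bishop type inequality: $r\mapsto V(r)/r^\nu$ is increasing or bounded, and $\sup_{x\in E}\mathfrak m(B_r(x))\le V(r)$ for all $r>0$. - Upper and lower heat kernel estimates: there are positive decreasing functions $\Phi_1,\Phi_2$ on $[0,+\infty[$ (possibly depending on $t_0$ if $t_0<+\infty$) with $\int_1^\infty \frac{(V(t)\lor t^\nu)\Phi_2(t)}{t}\,dt<+\infty$ and, for all $x,y\in E$, $t\in]0,t_0[$,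 $$\frac{1}{t^{\nu/\beta}}\Phi_1\Big(\frac{d(x,y)}{t^{1/\beta}}\Big)\le p_t(x,y)\le \frac{1}{t^{\nu/\beta}}\Phi_2\Big(\frac{d(x,y)}{t^{1/\beta}}\Big).$$ Classes of measures. - Put $G(r)=r^{\beta-\nu}$ for $r\in]0,+\infty[$ if $\nu>\beta$, $G(r)=\log(r^{-1})$ for $r\in]0,1[$ if $\nu=\beta$, $G(0)=+\infty$, and $G(x,y)=G(d(x,y))$. $D_{\nu,\beta}^{\,p}$ is the set of positive Borel measures $\mu$ on $E$ such that: if $\nu\ge\beta$, $\sup_{x\in E}\int_{d(x,y)<r}G(x,y)^p\mu(dy)<+\infty$ for some $r>0$ ($r<1$ if $\nu=\beta$); if $\nu<\beta$, $\sup_{x\in E}\int_{d(x,y)\le1}\mu(dy)<+\infty$. - $K_{\nu,\beta}^{\,p}$ is the set of positive Borel measures $\mu$ on $E$ such that: if $\nu\ge\beta$, $\lim_{r\to0}\sup_{x\in E}\int_{d(x,y)<r}G(x,y)^p\mu(dy)=0$; if $\nu<\beta$, $\sup_{x\in E}\int_{d(x,y)\le1}\mu(dy)<+\infty$. *)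

theory Defs
  imports "HOL-Probability.Probability"
begin

section \<open>Measures on a metric space\<close>

definition radon_measure :: "'a::metric_space measure \<Rightarrow> bool" where
  "radon_measure M \<longleftrightarrow>
     sets M = sets borel \<and>
     (\<forall>K. compact K \<longrightarrow> emeasure M K < \<infinity>) \<and>
     (\<forall>A\<in>sets borel. emeasure M A = (INF U\<in>{U. open U \<and> A \<subseteq> U}. emeasure M U)) \<and>
     (\<forall>U. open U \<longrightarrow> emeasure M U = (SUP K\<in>{K. compact K \<and> K \<subseteq> U}. emeasure M K))"

definition full_support :: "'a::metric_space measure \<Rightarrow> bool" where
  "full_support M \<longleftrightarrow> (\<forall>U. open U \<and> U \<noteq> {} \<longrightarrow> 0 < emeasure M U)"


section \<open>Symmetric regular Dirichlet forms\<close>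

text \<open>Elements of \<open>L\<^sup>2\<close> are given by Borel representatives; all the notions
  below are required to be compatible with almost everywhere equality.\<close>

definition L2 :: "'a measure \<Rightarrow> ('a \<Rightarrow> real) set" where
  "L2 M = {f \<in> borel_measurable M. integrable M (\<lambda>x. (f x)\<^sup>2)}"

definition L2_inner :: "'a measure \<Rightarrow> ('a \<Rightarrow> real) \<Rightarrow> ('a \<Rightarrow> real) \<Rightarrow> real" where
  "L2_inner M f g = (\<integral>x. f x * g x \<partial>M)"

definition L2_norm :: "'a measure \<Rightarrow> ('a \<Rightarrow> real) \<Rightarrow> real" where
  "L2_norm M f = sqrt (L2_inner M f f)"

definition symmetric_form ::
  "'a measure \<Rightarrow> (('a \<Rightarrow> real) \<Rightarrow> ('a \<Rightarrow> real) \<Rightarrow> real) \<Rightarrow> ('a \<Rightarrow> real) set \<Rightarrow> bool" where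
  "symmetric_form M \<E> F \<longleftrightarrow>
     F \<subseteq> L2 M \<and>
     (\<lambda>x. 0) \<in> F \<and>
     (\<forall>f\<in>F. \<forall>g\<in>F. (\<lambda>x. f x + g x) \<in> F) \<and>
     (\<forall>c. \<forall>f\<in>F. (\<lambda>x. c * f x) \<in> F) \<and>
     (\<forall>f\<in>F. \<forall>g\<in>borel_measurable M. (AE x in M. f x = g x) \<longrightarrow>
        g \<in> F \<and> (\<forall>h\<in>F. \<E> f h = \<E> g h)) \<and>
     (\<forall>f\<in>L2 M. \<forall>e>0. \<exists>g\<in>F. L2_norm M (\<lambda>x. f x - g x) < e) \<and>
     (\<forall>f\<in>F. \<forall>g\<in>F. \<forall>h\<in>F. \<E> (\<lambda>x. f x + g x) h = \<E> f h + \<E> g h) \<and>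
     (\<forall>c. \<forall>f\<in>F. \<forall>h\<in>F. \<E> (\<lambda>x. c * f x) h = c * \<E> f h) \<and>
     (\<forall>f\<in>F. \<forall>g\<in>F. \<E> f g = \<E> g f) \<and>
     (\<forall>f\<in>F. 0 \<le> \<E> f f)"

definition form_1 ::
  "'a measure \<Rightarrow> (('a \<Rightarrow> real) \<Rightarrow> ('a \<Rightarrow> real) \<Rightarrow> real) \<Rightarrow> ('a \<Rightarrow> real) \<Rightarrow> ('a \<Rightarrow> real) \<Rightarrow> real" where
  "form_1 M \<E> f g = \<E> f g + L2_inner M f g"

definition closed_form ::
  "'a measure \<Rightarrow> (('a \<Rightarrow> real) \<Rightarrow> ('a \<Rightarrow> real) \<Rightarrow> real) \<Rightarrow> ('a \<Rightarrow> real) set \<Rightarrow> bool" where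
  "closed_form M \<E> F \<longleftrightarrow>
     (\<forall>u::nat \<Rightarrow> 'a \<Rightarrow> real.
        (\<forall>n. u n \<in> F) \<and>
        (\<forall>e>0. \<exists>N. \<forall>m\<ge>N. \<forall>n\<ge>N.
           form_1 M \<E> (\<lambda>x. u m x - u n x) (\<lambda>x. u m x - u n x) < e) \<longrightarrow>
        (\<exists>v\<in>F. (\<lambda>n. form_1 M \<E> (\<lambda>x. u n x - v x) (\<lambda>x. u n x - v x)) \<longlonglongrightarrow> 0))"

text \<open>The Markov property is that the unit contraction operates.\<close>

definition dirichlet_form ::
  "'a measure \<Rightarrow> (('a \<Rightarrow> real) \<Rightarrow> ('a \<Rightarrow> real) \<Rightarrow> real) \<Rightarrow> ('a \<Rightarrow> real) set \<Rightarrow> bool" where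
  "dirichlet_form M \<E> F \<longleftrightarrow>
     symmetric_form M \<E> F \<and>
     closed_form M \<E> F \<and>
     (\<forall>u\<in>F. (\<lambda>x. min (max (u x) 0) 1) \<in> F \<and>
        \<E> (\<lambda>x. min (max (u x) 0) 1) (\<lambda>x. min (max (u x) 0) 1) \<le> \<E> u u)"

definition Cc :: "('a::metric_space \<Rightarrow> real) set" where
  "Cc = {u. continuous_on UNIV u \<and> compact (closure {x. u x \<noteq> 0})}"

definition regular_dirichlet_form ::
  "'a::metric_space measure \<Rightarrow> (('a \<Rightarrow> real) \<Rightarrow> ('a \<Rightarrow> real) \<Rightarrow> real) \<Rightarrow> ('a \<Rightarrow> real) set \<Rightarrow> bool" where
  "regular_dirichlet_form M \<E> F \<longleftrightarrow>
     dirichlet_form M \<E> F \<and>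
     (\<forall>u\<in>F. \<forall>e>0. \<exists>v\<in>F \<inter> Cc. form_1 M \<E> (\<lambda>x. u x - v x) (\<lambda>x. u x - v x) < e) \<and>
     (\<forall>u\<in>Cc. \<forall>e>0. \<exists>v\<in>F \<inter> Cc. \<forall>x. \<bar>u x - v x\<bar> < e)"

text \<open>Strongly continuous symmetric contraction semigroups on \<open>L\<^sup>2\<close>.\<close>

definition L2_semigroup ::
  "'a measure \<Rightarrow> (real \<Rightarrow> ('a \<Rightarrow> real) \<Rightarrow> 'a \<Rightarrow> real) \<Rightarrow> bool" where
  "L2_semigroup M T \<longleftrightarrow>
     (\<forall>t>0. \<forall>f\<in>L2 M. T t f \<in> L2 M) \<and>
     (\<forall>t>0. \<forall>f\<in>L2 M. \<forall>g\<in>L2 M. (AE x in M. f x = g x) \<longrightarrow> (AE x in M. T t f x = T t g x)) \<and>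
     (\<forall>t>0. \<forall>f\<in>L2 M. \<forall>g\<in>L2 M. AE x in M. T t (\<lambda>y. f y + g y) x = T t f x + T t g x) \<and>
     (\<forall>t>0. \<forall>c. \<forall>f\<in>L2 M. AE x in M. T t (\<lambda>y. c * f y) x = c * T t f x) \<and>
     (\<forall>t>0. \<forall>f\<in>L2 M. \<forall>g\<in>L2 M. L2_inner M (T t f) g = L2_inner M f (T t g)) \<and>
     (\<forall>t>0. \<forall>f\<in>L2 M. L2_norm M (T t f) \<le> L2_norm M f) \<and>
     (\<forall>s>0. \<forall>t>0. \<forall>f\<in>L2 M. AE x in M. T (s + t) f x = T s (T t f) x) \<and>
     (\<forall>f\<in>L2 M. ((\<lambda>t. L2_norm M (\<lambda>x. T t f x - f x)) \<longlongrightarrow> 0) (at_right 0))"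

text \<open>The form of a semigroup: \<open>\<E>(u,v) = lim (u - T\<^sub>t u, v) / t\<close> as \<open>t\<close> decreases
  to 0, with domain the set of \<open>u\<close> for which the (monotone) limit is finite for \<open>v = u\<close>.\<close>

definition form_of_semigroup ::
  "'a measure \<Rightarrow> (real \<Rightarrow> ('a \<Rightarrow> real) \<Rightarrow> 'a \<Rightarrow> real) \<Rightarrow>
   (('a \<Rightarrow> real) \<Rightarrow> ('a \<Rightarrow> real) \<Rightarrow> real) \<Rightarrow> ('a \<Rightarrow> real) set \<Rightarrow> bool" where
  "form_of_semigroup M T \<E> F \<longleftrightarrow>
     F = {u \<in> L2 M. \<exists>c. ((\<lambda>t. L2_inner M (\<lambda>x. u x - T t u x) u / t) \<longlongrightarrow> c) (at_right 0)} \<and>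
     (\<forall>u\<in>F. \<forall>v\<in>F. ((\<lambda>t. L2_inner M (\<lambda>x. u x - T t u x) v / t) \<longlongrightarrow> \<E> u v) (at_right 0))"


section \<open>Hunt processes\<close>

text \<open>The state space with the cemetery \<open>None\<close> adjoined is the one-point compactification
  (with \<open>None\<close> isolated if the space is compact). Time runs through \<open>[0,\<infinity>]\<close>.\<close>

abbreviation cemetery_top :: "'a::metric_space option topology" where
  "cemetery_top \<equiv> Alexandroff_compactification euclidean"

definition cemetery_borel :: "'a::metric_space option measure" where
  "cemetery_borel = sigma UNIV {U. openin cemetery_top U}"

definition lifetime :: "(ennreal \<Rightarrow> 'w \<Rightarrow> 'a option) \<Rightarrow> 'w \<Rightarrow> ennreal" where
  "lifetime X \<omega> = Inf {t. X t \<omega> = None}"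

definition natural_filtration ::
  "'w set \<Rightarrow> (ennreal \<Rightarrow> 'w \<Rightarrow> 'a::metric_space option) \<Rightarrow> ennreal \<Rightarrow> 'w measure" where
  "natural_filtration \<Omega> X t =
     sigma \<Omega> {X s -` B \<inter> \<Omega> | s B. s \<le> t \<and> B \<in> sets cemetery_borel}"

text \<open>The index \<open>\<infinity>\<close> is inserted so that the intersection at \<open>t = \<infinity>\<close> is not over the empty set.\<close>

definition right_filtration ::
  "'w set \<Rightarrow> (ennreal \<Rightarrow> 'w \<Rightarrow> 'a::metric_space option) \<Rightarrow> ennreal \<Rightarrow> 'w measure" where
  "right_filtration \<Omega> X t =
     sigma \<Omega> (\<Inter>s\<in>insert \<infinity> {t<..}. sets (natural_filtration \<Omega> X s))"

text \<open>The law with initial distribution \<open>\<mu>\<close>, on the \<open>\<sigma>\<close>-algebra generated by the process.\<close>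

definition initial_law ::
  "'w set \<Rightarrow> (ennreal \<Rightarrow> 'w \<Rightarrow> 'a::metric_space option) \<Rightarrow> ('a option \<Rightarrow> 'w measure) \<Rightarrow>
   'a option measure \<Rightarrow> 'w measure" where
  "initial_law \<Omega> X P \<mu> =
     measure_of \<Omega> (sets (natural_filtration \<Omega> X \<infinity>)) (\<lambda>A. \<integral>\<^sup>+x. emeasure (P x) A \<partial>\<mu>)"

text \<open>A process is Hunt if it is normal, has cadlag paths absorbed at the cemetery, admits
  shifts, and is strong Markov and quasi-left-continuous for some right-continuous admissible
  filtration. The right-continuous natural filtration is the smallest such filtration, so nothing
  is lost in using it. The simple Markov property is the case of constant stopping times.\<close>

definition hunt_process ::
  "'w measure \<Rightarrow> (ennreal \<Rightarrow> 'w \<Rightarrow> 'a::metric_space option) \<Rightarrow> ('a option \<Rightarrow> 'w measure) \<Rightarrow> bool" where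
  "hunt_process W X P \<longleftrightarrow>
     (let \<Omega> = space W; \<G> = right_filtration \<Omega> X in
     (\<forall>t. X t \<in> measurable W cemetery_borel) \<and>
     (\<forall>x. sets (P x) = sets W \<and> prob_space (P x)) \<and>
     (\<forall>t. \<forall>B\<in>sets cemetery_borel.
        (\<lambda>x. emeasure (P x) {\<omega>\<in>\<Omega>. X t \<omega> \<in> B}) \<in> borel_measurable cemetery_borel) \<and>
     (\<forall>x. AE \<omega> in P x. X 0 \<omega> = x) \<and>
     (\<forall>\<omega>\<in>\<Omega>. X \<infinity> \<omega> = None) \<and>
     (\<forall>\<omega>\<in>\<Omega>. \<forall>t\<ge>lifetime X \<omega>. X t \<omega> = None) \<and>
     (\<exists>\<theta>. \<forall>t. \<theta> t \<in> \<Omega> \<rightarrow> \<Omega> \<and> (\<forall>\<omega>\<in>\<Omega>. \<forall>s. X s (\<theta> t \<omega>) = X (s + t) \<omega>)) \<and>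
     (\<forall>\<omega>\<in>\<Omega>. \<forall>t<\<infinity>. limitin cemetery_top (\<lambda>s. X s \<omega>) (X t \<omega>) (at_right t)) \<and>
     (\<forall>\<omega>\<in>\<Omega>. \<forall>t. 0 < t \<and> t < \<infinity> \<longrightarrow> (\<exists>l. limitin cemetery_top (\<lambda>s. X s \<omega>) l (at_left t))) \<and>
     (\<forall>\<mu>. sets \<mu> = sets cemetery_borel \<and> prob_space \<mu> \<longrightarrow>
        (\<forall>\<sigma>. stopping_time \<G> \<sigma> \<longrightarrow> (\<forall>s. \<forall>B\<in>sets cemetery_borel.
           AE \<omega> in initial_law \<Omega> X P \<mu>.
             real_cond_exp (initial_law \<Omega> X P \<mu>) (filtration.pre_sigma \<Omega> \<G> \<sigma>)
               (indicator {\<omega>\<in>\<Omega>. X (\<sigma> \<omega> + s) \<omega> \<in> B}) \<omega>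
             = measure (P (X (\<sigma> \<omega>) \<omega>)) {\<omega>'\<in>\<Omega>. X s \<omega>' \<in> B})) \<and>
        (\<forall>\<sigma> \<tau>. (\<forall>n::nat. stopping_time \<G> (\<tau> n)) \<and>
            (\<forall>\<omega>\<in>\<Omega>. incseq (\<lambda>n. \<tau> n \<omega>) \<and> \<sigma> \<omega> = (SUP n. \<tau> n \<omega>)) \<longrightarrow>
           (AE \<omega> in initial_law \<Omega> X P \<mu>. \<sigma> \<omega> < \<infinity> \<longrightarrow>
              limitin cemetery_top (\<lambda>n. X (\<tau> n \<omega>) \<omega>) (X (\<sigma> \<omega>) \<omega>) sequentially))))"

text \<open>\<open>\<^bold>E\<^sub>x[u(X\<^sub>t)]\<close>, with the usual convention that \<open>u\<close> vanishes at the cemetery.\<close>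

definition transition ::
  "(ennreal \<Rightarrow> 'w \<Rightarrow> 'a option) \<Rightarrow> ('a option \<Rightarrow> 'w measure) \<Rightarrow> real \<Rightarrow> ('a \<Rightarrow> real) \<Rightarrow> 'a \<Rightarrow> real" where
  "transition X P t u x =
     (\<integral>\<omega>. (case X (ennreal t) \<omega> of None \<Rightarrow> 0 | Some y \<Rightarrow> u y) \<partial>P (Some x))"

definition associated ::
  "'a measure \<Rightarrow> (('a \<Rightarrow> real) \<Rightarrow> ('a \<Rightarrow> real) \<Rightarrow> real) \<Rightarrow> ('a \<Rightarrow> real) set \<Rightarrow>
   (ennreal \<Rightarrow> 'w \<Rightarrow> 'a option) \<Rightarrow> ('a option \<Rightarrow> 'w measure) \<Rightarrow> bool" where
  "associated M \<E> F X P \<longleftrightarrow>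
     (\<exists>T. L2_semigroup M T \<and> form_of_semigroup M T \<E> F \<and>
        (\<forall>t>0. \<forall>u\<in>L2 M. bounded (range u) \<longrightarrow> (AE x in M. transition X P t u x = T t u x)))"

definition semigroup_kernel ::
  "'a::metric_space measure \<Rightarrow> (ennreal \<Rightarrow> 'w \<Rightarrow> 'a option) \<Rightarrow> ('a option \<Rightarrow> 'w measure) \<Rightarrow>
   (real \<Rightarrow> 'a \<Rightarrow> 'a \<Rightarrow> real) \<Rightarrow> bool" where
  "semigroup_kernel M X P k \<longleftrightarrow>
     (\<lambda>(t, x, y). k t x y) \<in>
       borel_measurable (restrict_space borel {0<..} \<Otimes>\<^sub>M borel \<Otimes>\<^sub>M borel) \<and>
     (\<forall>t>0. \<forall>x y. 0 \<le> k t x y) \<and>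
     (\<forall>t>0. \<forall>x. \<forall>u\<in>borel_measurable borel. bounded (range u) \<longrightarrow>
        transition X P t u x = (\<integral>y. k t x y * u y \<partial>M)) \<and>
     (\<forall>s>0. \<forall>t>0. \<forall>x y. ennreal (k (t + s) x y) = (\<integral>\<^sup>+z. ennreal (k s x z * k t z y) \<partial>M)) \<and>
     (\<forall>t>0. \<forall>x. (\<integral>\<^sup>+y. ennreal (k t x y) \<partial>M) \<le> 1)"


section \<open>Volume growth and heat kernel estimates\<close>

definition bishop_inequality :: "'a::metric_space measure \<Rightarrow> real \<Rightarrow> (real \<Rightarrow> real) \<Rightarrow> bool" where
  "bishop_inequality M \<nu> V \<longleftrightarrow>
     (mono_on {0<..} (\<lambda>r. V r / r powr \<nu>) \<or> bounded ((\<lambda>r. V r / r powr \<nu>) ` {0<..})) \<and>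
     (\<forall>r>0. (SUP x. emeasure M (ball x r)) \<le> ennreal (V r))"

definition heat_kernel_estimates ::
  "real \<Rightarrow> real \<Rightarrow> ereal \<Rightarrow> (real \<Rightarrow> real) \<Rightarrow> (real \<Rightarrow> 'a::metric_space \<Rightarrow> 'a \<Rightarrow> real) \<Rightarrow> bool" where
  "heat_kernel_estimates \<nu> \<beta> t\<^sub>0 V k \<longleftrightarrow>
     (\<exists>\<Phi>\<^sub>1 \<Phi>\<^sub>2 :: real \<Rightarrow> real.
        (\<forall>s\<ge>0. 0 < \<Phi>\<^sub>1 s) \<and> antimono_on {0..} \<Phi>\<^sub>1 \<and>
        (\<forall>s\<ge>0. 0 < \<Phi>\<^sub>2 s) \<and> antimono_on {0..} \<Phi>\<^sub>2 \<and>
        (\<integral>\<^sup>+t\<in>{1..}. ennreal (max (V t) (t powr \<nu>) * \<Phi>\<^sub>2 t / t) \<partial>lborel) < \<infinity> \<and>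
        (\<forall>x y. \<forall>t>0. ereal t < t\<^sub>0 \<longrightarrow>
           1 / t powr (\<nu> / \<beta>) * \<Phi>\<^sub>1 (dist x y / t powr (1 / \<beta>)) \<le> k t x y \<and>
           k t x y \<le> 1 / t powr (\<nu> / \<beta>) * \<Phi>\<^sub>2 (dist x y / t powr (1 / \<beta>))))"


section \<open>The classes of measures\<close>

text \<open>Meaningful for \<open>\<nu> \<ge> \<beta>\<close> only and, if \<open>\<nu> = \<beta>\<close>, for \<open>r < 1\<close> only.\<close>

definition green :: "real \<Rightarrow> real \<Rightarrow> real \<Rightarrow> ennreal" where
  "green \<nu> \<beta> r =
     (if r = 0 then \<infinity> else if \<nu> > \<beta> then ennreal (r powr (\<beta> - \<nu>)) else ennreal (ln (inverse r)))"

definition ennreal_powr :: "ennreal \<Rightarrow> real \<Rightarrow> ennreal" where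
  "ennreal_powr a p = (if a = \<infinity> then \<infinity> else ennreal (enn2real a powr p))"

definition class_D :: "real \<Rightarrow> real \<Rightarrow> real \<Rightarrow> 'a::metric_space measure set" where
  "class_D \<nu> \<beta> p = {\<mu>. sets \<mu> = sets borel \<and>
     (if \<nu> \<ge> \<beta>
      then \<exists>r>0. (\<nu> = \<beta> \<longrightarrow> r < 1) \<and>
             (SUP x. \<integral>\<^sup>+y\<in>ball x r. ennreal_powr (green \<nu> \<beta> (dist x y)) p \<partial>\<mu>) < \<infinity>
      else (SUP x. emeasure \<mu> (cball x 1)) < \<infinity>)}"

definition class_K :: "real \<Rightarrow> real \<Rightarrow> real \<Rightarrow> 'a::metric_space measure set" where
  "class_K \<nu> \<beta> p = {\<mu>. sets \<mu> = sets borel \<and>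
     (if \<nu> \<ge> \<beta>
      then ((\<lambda>r. SUP x. \<integral>\<^sup>+y\<in>ball x r. ennreal_powr (green \<nu> \<beta> (dist x y)) p \<partial>\<mu>) \<longlongrightarrow> 0) (at_right 0)
      else (SUP x. emeasure \<mu> (cball x 1)) < \<infinity>)}"

end

theory Submission
  imports Defs "HOL-Real_Asymp.Real_Asymp"
begin

text \<open>
  Write \<open>\<gamma> = p(\<nu> - \<beta>)\<close>. For \<open>\<nu> > \<beta>\<close> the weight \<open>G(x,y)\<^sup>p\<close> is \<open>d(x,y)\<close> to the
  power \<open>-\<gamma>\<close>, so everything compares this power with the growth exponent \<open>\<eta>\<close> of \<open>\<mu>\<close>.

  If \<open>\<mu>(B\<^sub>r(x)) \<le> C r\<^sup>\<eta>\<close> uniformly in \<open>x\<close> and \<open>\<gamma> < \<eta>\<close>, then splitting \<open>B\<^sub>r(x)\<close> into dyadic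
  annuli bounds the integral of the weight over \<open>B\<^sub>r(x)\<close> by a geometric series, of size \<open>r\<close> to the
  power \<open>\<eta> - \<gamma>\<close>, and this tends to \<open>0\<close> (\<open>nn_integral_dist_powr_le\<close>,
  \<open>class_K_if_upper_regular\<close>). For \<open>\<nu> = \<beta>\<close> the logarithmic weight is dominated by an arbitrarily
  small negative power of the distance.

  Conversely, let the integral of the weight over some ball around \<open>x\<^sub>0\<close> be finite and \<open>\<gamma> > 0\<close>. The
  weight is infinite at \<open>x\<^sub>0\<close>, so \<open>x\<^sub>0\<close> is not an atom, and the integrals over \<open>B\<^sub>r(x\<^sub>0)\<close> tend to
  \<open>0\<close> with \<open>r\<close>. Each is at least \<open>\<mu>(B\<^sub>r(x\<^sub>0))\<close> times \<open>r\<close> to the power \<open>-\<gamma>\<close>, hence at least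
  \<open>C\<^sub>1\<close> times \<open>r\<close> to the power \<open>\<eta> - \<gamma>\<close>. This forces \<open>\<gamma> < \<eta>\<close>
  (\<open>exponent_less_if_class_D\<close>), which yields the weak and the strict inequality at once.

  For \<open>\<nu> < \<beta>\<close> both classes ask that \<open>\<mu>\<close> be uniformly bounded on balls of radius \<open>1\<close>, while the
  hypothesis concerns balls of radius at most \<open>r\<^sub>0\<close>, and \<open>r\<^sub>0\<close> may be less than \<open>1\<close>. What is needed
  is a covering of every unit ball by small balls, their number not depending on its centre. This
  is where the heat kernel enters. By the semigroup property and the two-sided estimate,
  \<open>p\<^sub>2\<^sub>t(z,z) = \<integral> p\<^sub>t(z,w) p\<^sub>t(w,z) m(dw)\<close> is bounded below; the part of the integral away from
  \<open>B\<^sub>r(z)\<close> is comparatively small for small \<open>t\<close>, so \<open>m(B\<^sub>r(z))\<close> is bounded below uniformly in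
  \<open>z\<close> (\<open>volume_lower_bound\<close>). Together with \<open>m(B\<^sub>2(x)) \<le> V(2)\<close> this limits the size of separated
  subsets of a unit ball, and a maximal one gives the covering (\<open>cball_cover_by_packing\<close>).
\<close>


section \<open>Integrals over shrinking sets\<close>

lemma nn_integral_decseq_tendsto_0:
  fixes f :: "'a \<Rightarrow> ennreal"
  assumes f: "f \<in> borel_measurable M" and A: "\<And>n::nat. A n \<in> sets M" and "decseq A"
    and null: "emeasure M (\<Inter>n. A n) = 0" and fin: "(\<integral>\<^sup>+y\<in>A 0. f y \<partial>M) < \<infinity>"
  shows "(\<lambda>n. \<integral>\<^sup>+y\<in>A n. f y \<partial>M) \<longlonglongrightarrow> 0"
proof -
  let ?N = "density M f"
  have eq: "emeasure ?N (A n) = (\<integral>\<^sup>+y\<in>A n. f y \<partial>M)" for n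
    using f A by (simp add: emeasure_density)
  have "emeasure ?N (A n) \<noteq> \<infinity>" for n
  proof -
    have "emeasure ?N (A n) \<le> emeasure ?N (A 0)"
      using \<open>decseq A\<close> A by (intro emeasure_mono) (auto simp: decseq_def)
    then show ?thesis
      using fin eq[of 0] by (auto simp: top_unique)
  qed
  then have "(\<lambda>n. emeasure ?N (A n)) \<longlonglongrightarrow> emeasure ?N (\<Inter>n. A n)"
    using A \<open>decseq A\<close> by (intro Lim_emeasure_decseq) auto
  moreover have "emeasure ?N (\<Inter>n. A n) = 0"
  proof -
    have "(\<Inter>n. A n) \<in> sets M" using A by auto
    then have "(\<Inter>n. A n) \<in> null_sets M" using null by auto
    then have "(\<Inter>n. A n) \<in> null_sets ?N"
      using absolutely_continuousI_density[OF f] by (auto simp: absolutely_continuous_def)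
    then show ?thesis by auto
  qed
  ultimately show ?thesis by (simp add: eq)
qed


section \<open>Integrals of negative powers of the distance\<close>

lemma dyadic_scale:
  fixes d r :: real
  assumes "0 < d" "d < r"
  obtains n where "r * (1/2) ^ Suc n \<le> d" "d < r * (1/2) ^ n"
proof -
  have "0 < d / r" using assms by auto
  then obtain k where "(1/2::real) ^ k < d / r"
    using real_arch_pow_inv[of "d/r" "1/2"] by auto
  then have "\<exists>k. r * (1/2) ^ k \<le> d"
    using assms by (auto simp: field_simps intro!: exI[of _ k])
  then obtain k where k: "r * (1/2) ^ k \<le> d" "\<And>i. i < k \<Longrightarrow> \<not> r * (1/2) ^ i \<le> d"
    using exists_least_iff[of "\<lambda>k. r * (1/2) ^ k \<le> d"] by blast
  have "k \<noteq> 0" using k(1) assms by (cases k) auto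
  then obtain n where n: "k = Suc n" by (cases k) auto
  show ?thesis using k(1) k(2)[of n] n that[of n] by auto
qed

lemma singleton_null:
  fixes M :: "'a::metric_space measure"
  assumes M: "sets M = sets borel" and R: "0 < R" and "0 < \<eta>"
    and ub: "\<And>r. 0 < r \<Longrightarrow> r \<le> R \<Longrightarrow> emeasure M (ball x r) \<le> ennreal (C * r powr \<eta>)"
  shows "emeasure M {x} = 0"
proof -
  have "((\<lambda>r. ennreal (C * r powr \<eta>)) \<longlongrightarrow> ennreal (C * 0)) (at_right 0)"
    using \<open>0 < \<eta>\<close> by (intro tendsto_ennrealI tendsto_mult tendsto_const) real_asymp
  moreover have "\<forall>\<^sub>F r in at_right (0::real). emeasure M {x} \<le> ennreal (C * r powr \<eta>)"
    using eventually_at_right_real[OF R]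
  proof eventually_elim
    case (elim r)
    then have "emeasure M {x} \<le> emeasure M (ball x r)"
      using M by (intro emeasure_mono) auto
    also have "\<dots> \<le> ennreal (C * r powr \<eta>)" using ub elim by auto
    finally show ?case .
  qed
  ultimately have "emeasure M {x} \<le> ennreal (C * 0)"
    by (intro tendsto_lowerbound) auto
  then show ?thesis by simp
qed

text \<open>
  On the annulus of outer radius \<open>r / 2\<^sup>n\<close> and half that inner radius, the negative power of the
  distance is at most its value at the inner radius, and the measure is at most that of the ball.
  The resulting series is geometric with ratio \<open>1/2\<close> to the power \<open>\<eta> - \<gamma>\<close>. The bound on \<open>f\<close> is
  asked off \<open>x\<close> only, since the weights of interest are infinite there and the growth condition
  excludes an atom.
\<close>

lemma nn_integral_dist_powr_le:
  fixes M :: "'a::metric_space measure"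
  assumes M: "sets M = sets borel" and "0 \<le> C" "0 \<le> D" "0 \<le> \<gamma>" "\<gamma> < \<eta>" "0 < r" "r \<le> R"
    and ub: "\<And>r. 0 < r \<Longrightarrow> r \<le> R \<Longrightarrow> emeasure M (ball x r) \<le> ennreal (C * r powr \<eta>)"
    and f: "\<And>y. y \<noteq> x \<Longrightarrow> dist x y < r \<Longrightarrow> f y \<le> ennreal (D * dist x y powr (-\<gamma>))"
  shows "(\<integral>\<^sup>+y\<in>ball x r. f y \<partial>M)
    \<le> ennreal (D * C * 2 powr \<gamma> / (1 - (1/2) powr (\<eta> - \<gamma>)) * r powr (\<eta> - \<gamma>))"
proof -
  let ?\<rho> = "\<lambda>n. r * (1/2) ^ n"
  let ?c = "\<lambda>n. D * ?\<rho> (Suc n) powr (-\<gamma>)"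
  let ?q = "(1/2::real) powr (\<eta> - \<gamma>)"
  let ?A = "D * C * 2 powr \<gamma> * r powr (\<eta> - \<gamma>)"
  have q: "0 \<le> ?q" "?q < 1"
    using \<open>\<gamma> < \<eta>\<close> powr_less_mono'[of "1/2" 0 "\<eta> - \<gamma>"] by auto
  have \<rho>: "0 < ?\<rho> n" "?\<rho> n \<le> R" for n
    using \<open>0 < r\<close> \<open>r \<le> R\<close> mult_mono[of r R "(1/2::real)^n" 1] power_le_one[of "1/2::real" n]
    by auto
  have meas: "ball x e \<in> sets M" for e using M by auto
  \<comment> \<open>the centre lies in no annulus\<close>
  have "emeasure M {x} = 0"
    using M ub \<open>0 \<le> \<gamma>\<close> \<open>\<gamma> < \<eta>\<close> \<open>0 < r\<close> \<open>r \<le> R\<close> by (intro singleton_null[of M R \<eta>]) auto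
  then have "{x} \<in> null_sets M" using M by auto
  then have "AE y in M. y \<notin> {x}" by (rule AE_not_in)
  then have "AE y in M. f y * indicator (ball x r) y
      \<le> (\<Sum>n. ennreal (?c n) * indicator (ball x (?\<rho> n)) y)"
  proof eventually_elim
    case (elim y)
    show ?case
    proof (cases "dist x y < r")
      case True
      then obtain n where n: "?\<rho> (Suc n) \<le> dist x y" "dist x y < ?\<rho> n"
        using dyadic_scale[of "dist x y" r] elim by auto
      have "f y \<le> ennreal (D * dist x y powr (-\<gamma>))" using f elim True by auto
      also have "\<dots> \<le> ennreal (?c n)"
        using n \<rho>[of "Suc n"] \<open>0 \<le> D\<close> \<open>0 \<le> \<gamma>\<close>
        by (intro ennreal_leI mult_left_mono powr_mono2') auto
      finally have "f y * indicator (ball x r) y \<le> ennreal (?c n) * indicator (ball x (?\<rho> n)) y"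
        using True n by auto
      also have "\<dots> \<le> (\<Sum>n. ennreal (?c n) * indicator (ball x (?\<rho> n)) y)"
        using sum_le_suminf[of "\<lambda>n. ennreal (?c n) * indicator (ball x (?\<rho> n)) y" "{n}"]
        by (simp del: sum_mult_indicator mult_indicator_subset)
      finally show ?thesis .
    qed auto
  qed
  then have "(\<integral>\<^sup>+y\<in>ball x r. f y \<partial>M)
      \<le> (\<integral>\<^sup>+y. (\<Sum>n. ennreal (?c n) * indicator (ball x (?\<rho> n)) y) \<partial>M)"
    by (rule nn_integral_mono_AE)
  also have "\<dots> = (\<Sum>n. \<integral>\<^sup>+y. ennreal (?c n) * indicator (ball x (?\<rho> n)) y \<partial>M)"
    using meas by (intro nn_integral_suminf) auto
  also have "\<dots> = (\<Sum>n. ennreal (?c n) * emeasure M (ball x (?\<rho> n)))"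
    using meas by (simp add: nn_integral_cmult_indicator)
  also have "\<dots> \<le> (\<Sum>n. ennreal (?A * ?q ^ n))"
  proof (intro suminf_le summableI)
    fix n
    have "ennreal (?c n) * emeasure M (ball x (?\<rho> n)) \<le> ennreal (?c n) * ennreal (C * ?\<rho> n powr \<eta>)"
      using ub \<rho> by (intro mult_left_mono) auto
    also have "\<dots> = ennreal (?c n * (C * ?\<rho> n powr \<eta>))"
      using \<open>0 \<le> D\<close> \<open>0 \<le> C\<close> by (simp add: ennreal_mult)
    also have "?c n * (C * ?\<rho> n powr \<eta>) = ?A * ?q ^ n"
    proof -
      have 1: "?\<rho> (Suc n) powr (-\<gamma>) = 2 powr \<gamma> * ?\<rho> n powr (-\<gamma>)"
        using \<rho>[of n] by (simp add: powr_mult powr_minus_divide powr_divide)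
      have 2: "?\<rho> n powr (-\<gamma>) * ?\<rho> n powr \<eta> = ?\<rho> n powr (\<eta> - \<gamma>)"
        by (simp add: powr_add[symmetric])
      have 3: "?\<rho> n powr (\<eta> - \<gamma>) = r powr (\<eta> - \<gamma>) * ?q ^ n"
        using \<open>0 < r\<close> by (simp add: powr_mult powr_powr powr_realpow[symmetric] mult.commute)
      have "?c n * (C * ?\<rho> n powr \<eta>)
          = D * C * 2 powr \<gamma> * (?\<rho> n powr (-\<gamma>) * ?\<rho> n powr \<eta>)"
        unfolding 1 by (simp only: mult_ac)
      also have "\<dots> = D * C * 2 powr \<gamma> * (r powr (\<eta> - \<gamma>) * ?q ^ n)"
        by (simp only: 2 3)
      finally show ?thesis by (simp only: mult.assoc)
    qed
    finally show "ennreal (?c n) * emeasure M (ball x (?\<rho> n)) \<le> ennreal (?A * ?q ^ n)" .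
  qed
  also have "\<dots> = ennreal (?A * (1 / (1 - ?q)))"
  proof (rule suminf_ennreal_eq)
    show "0 \<le> ?A * ?q ^ n" for n using q(1) \<open>0 \<le> D\<close> \<open>0 \<le> C\<close> by simp
    show "(\<lambda>n. ?A * ?q ^ n) sums (?A * (1 / (1 - ?q)))"
      using q by (intro sums_mult geometric_sums) simp
  qed
  finally show ?thesis by (simp add: field_simps)
qed

lemma green_powr_eq:
  assumes "\<beta> < \<nu>" "0 \<le> d"
  shows "ennreal_powr (green \<nu> \<beta> d) p
    = (if d = 0 then \<infinity> else ennreal (d powr (- (p * (\<nu> - \<beta>)))))"
  using assms by (simp add: ennreal_powr_def green_def powr_powr algebra_simps)

text \<open>
  A single power \<open>\<gamma> < \<eta>\<close> serves both shapes of the Green function. In the logarithmic case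
  \<open>\<gamma> = \<eta> / 2\<close> comes from the inequality \<open>ln u \<le> u\<^sup>a / a\<close> with \<open>a = \<eta> / (2 p)\<close>; any positive
  \<open>\<gamma> < \<eta>\<close> would do.
\<close>

lemma green_powr_le:
  assumes "\<beta> \<le> \<nu>" "1 \<le> p" "0 < \<eta>" "p * (\<nu> - \<beta>) < \<eta>"
  obtains \<gamma> D where "0 \<le> \<gamma>" "\<gamma> < \<eta>" "0 \<le> D"
    "\<And>d. 0 < d \<Longrightarrow> d < 1 \<Longrightarrow> ennreal_powr (green \<nu> \<beta> d) p \<le> ennreal (D * d powr (-\<gamma>))"
proof (cases "\<beta> < \<nu>")
  case True
  show ?thesis
    using that[of "p * (\<nu> - \<beta>)" 1] assms True by (auto simp: green_powr_eq)
next
  case False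
  define a where "a = \<eta> / (2 * p)"
  have a: "0 < a" "a * p = \<eta> / 2" using assms by (auto simp: a_def)
  have "ennreal_powr (green \<nu> \<beta> d) p \<le> ennreal ((1 / a) powr p * d powr (- (\<eta> / 2)))"
    if d: "0 < d" "d < 1" for d :: real
  proof -
    have "ln (inverse d) \<le> inverse d powr a / a"
      using d a by (intro ln_powr_bound) (auto simp: one_le_inverse)
    moreover have "0 \<le> ln (inverse d)" using d by (simp add: ln_inverse)
    ultimately have "ln (inverse d) powr p \<le> (inverse d powr a / a) powr p"
      using assms by (intro powr_mono2) auto
    also have "\<dots> = (1 / a) powr p * inverse d powr (\<eta> / 2)"
      using a(1) d by (simp add: powr_divide powr_powr a(2))
    also have "inverse d powr (\<eta> / 2) = d powr (- (\<eta> / 2))"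
      using d by (simp add: powr_minus inverse_powr)
    finally show ?thesis
      using False assms d \<open>0 \<le> ln (inverse d)\<close>
      by (auto simp: ennreal_powr_def green_def intro!: ennreal_leI)
  qed
  then show ?thesis using that[of "\<eta> / 2" "(1 / a) powr p"] \<open>0 < \<eta>\<close> by auto
qed

lemma class_K_if_upper_regular:
  fixes \<mu> :: "'a::metric_space measure"
  assumes \<mu>: "sets \<mu> = sets borel" and "\<beta> \<le> \<nu>" "1 \<le> p" "0 < \<eta>" "p * (\<nu> - \<beta>) < \<eta>"
    and R: "0 < R" and C: "0 < C"
    and ub: "\<And>x r. 0 < r \<Longrightarrow> r \<le> R \<Longrightarrow> emeasure \<mu> (ball x r) \<le> ennreal (C * r powr \<eta>)"
  shows "\<mu> \<in> class_K \<nu> \<beta> p"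
proof -
  obtain \<gamma> D where g: "0 \<le> \<gamma>" "\<gamma> < \<eta>" "0 \<le> D"
    "\<And>d. 0 < d \<Longrightarrow> d < 1 \<Longrightarrow> ennreal_powr (green \<nu> \<beta> d) p \<le> ennreal (D * d powr (-\<gamma>))"
    using green_powr_le assms by blast
  define I where
    "I r = (SUP x. \<integral>\<^sup>+y\<in>ball x r. ennreal_powr (green \<nu> \<beta> (dist x y)) p \<partial>\<mu>)" for r
  let ?A = "D * C * 2 powr \<gamma> / (1 - (1/2) powr (\<eta> - \<gamma>))"
  have "(I \<longlongrightarrow> 0) (at_right 0)"
  proof (rule tendsto_sandwich)
    show "\<forall>\<^sub>F r in at_right 0. 0 \<le> I r" by simp
    have "0 < min R 1" using R by auto
    from eventually_at_right_real[OF this]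
    show "\<forall>\<^sub>F r in at_right 0. I r \<le> ennreal (?A * r powr (\<eta> - \<gamma>))"
    proof eventually_elim
      case (elim r)
      then show ?case unfolding I_def
        using \<mu> C g ub by (intro SUP_least nn_integral_dist_powr_le[where R=R]) auto
    qed
    have "((\<lambda>r. ennreal (?A * r powr (\<eta> - \<gamma>))) \<longlongrightarrow> ennreal (?A * 0)) (at_right 0)"
      using g by (intro tendsto_ennrealI tendsto_mult tendsto_const) real_asymp
    then show "((\<lambda>r. ennreal (?A * r powr (\<eta> - \<gamma>))) \<longlongrightarrow> 0) (at_right 0)" by simp
  qed simp
  then show ?thesis using assms by (simp add: class_K_def I_def[abs_def])
qed

text \<open>
  For \<open>\<nu> > \<beta>\<close>, if \<open>\<eta>\<close> were at most \<open>\<gamma> = p(\<nu> - \<beta>)\<close>, the integral of the weight over a ball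
  about \<open>x\<close> would stay above \<open>C\<close> as the radius shrinks, which contradicts the absolute continuity
  of a finite integral. This is why the borderline case \<open>\<eta> = \<gamma>\<close> is excluded too.
\<close>

lemma exponent_less_if_class_D:
  fixes \<mu> :: "'a::metric_space measure"
  assumes D: "\<mu> \<in> class_D \<nu> \<beta> p" and "1 \<le> p" "0 < \<eta>" "0 < R" "0 < C"
    and lb: "\<And>r. 0 < r \<Longrightarrow> r \<le> R \<Longrightarrow> ennreal (C * r powr \<eta>) \<le> emeasure \<mu> (ball x r)"
  shows "p * (\<nu> - \<beta>) < \<eta>"
proof (cases "\<beta> < \<nu>")
  case False
  then have "p * (\<nu> - \<beta>) \<le> 0" using \<open>1 \<le> p\<close> by (intro mult_nonneg_nonpos) auto
  then show ?thesis using \<open>0 < \<eta>\<close> by linarith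
next
  case True
  define \<gamma> where "\<gamma> = p * (\<nu> - \<beta>)"
  have \<gamma>: "0 < \<gamma>" using True \<open>1 \<le> p\<close> by (simp add: \<gamma>_def)
  have \<mu>: "sets \<mu> = sets borel" using D by (simp add: class_D_def)
  have [measurable]: "(\<lambda>y. dist x y) \<in> borel_measurable borel"
    by (intro borel_measurable_continuous_onI continuous_intros)
  let ?f = "\<lambda>y. ennreal_powr (green \<nu> \<beta> (dist x y)) p"
  have f_eq: "?f y = (if dist x y = 0 then \<infinity> else ennreal (dist x y powr (-\<gamma>)))" for y
    using True by (simp add: green_powr_eq \<gamma>_def)
  have f: "?f \<in> borel_measurable \<mu>"
    unfolding f_eq measurable_cong_sets[OF \<mu> refl] by measurable
  obtain e where e: "0 < e"
    and "(SUP x. \<integral>\<^sup>+y\<in>ball x e. ennreal_powr (green \<nu> \<beta> (dist x y)) p \<partial>\<mu>) < \<infinity>"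
    using D True by (auto simp: class_D_def)
  then have fin: "(\<integral>\<^sup>+y\<in>ball x e. ?f y \<partial>\<mu>) < \<infinity>"
    by (meson SUP_upper UNIV_I le_less_trans)
  have null: "emeasure \<mu> {x} = 0"
  proof (rule ccontr)
    assume pos: "emeasure \<mu> {x} \<noteq> 0"
    have "\<infinity> * emeasure \<mu> {x} = (\<integral>\<^sup>+y. \<infinity> * indicator {x} y \<partial>\<mu>)"
      using \<mu> by (subst nn_integral_cmult_indicator) auto
    also have "\<dots> \<le> (\<integral>\<^sup>+y\<in>ball x e. ?f y \<partial>\<mu>)"
      unfolding f_eq using e by (intro nn_integral_mono) (auto simp add: indicator_def)
    finally show False using fin pos by (auto simp: ennreal_top_mult top_unique)
  qed
  \<comment> \<open>radii tending to \<open>0\<close>, admissible for both hypotheses and at most \<open>1\<close>, so that a nonpositive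
    power of them is at least \<open>1\<close>\<close>
  define \<rho> where "\<rho> n = min (min e R) 1 / real (Suc n)" for n
  have e': "0 < min (min e R) 1" using e \<open>0 < R\<close> by auto
  have \<rho>: "0 < \<rho> n" "\<rho> n \<le> min (min e R) 1" for n
    using e' divide_left_mono[of 1 "real (Suc n)" "min (min e R) 1"]
    unfolding \<rho>_def by (simp_all del: min.bounded_iff min_less_iff_conj of_nat_Suc)
  have dec: "decseq \<rho>"
    unfolding decseq_def \<rho>_def using e' by (intro allI impI divide_left_mono) auto
  have \<rho>0: "\<rho> \<longlonglongrightarrow> 0"
    unfolding \<rho>_def by (rule LIMSEQ_Suc, rule lim_const_over_n)
  have Int: "(\<Inter>n. ball x (\<rho> n)) = {x}"
  proof -
    have "y = x" if "\<And>n. dist x y < \<rho> n" for y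
      using LIMSEQ_le_const[OF \<rho>0, of "dist x y"] that by (force simp: less_imp_le)
    then show ?thesis using \<rho> by auto
  qed
  have "(\<lambda>n. \<integral>\<^sup>+y\<in>ball x (\<rho> n). ?f y \<partial>\<mu>) \<longlonglongrightarrow> 0"
  proof (rule nn_integral_decseq_tendsto_0[OF f])
    show "ball x (\<rho> n) \<in> sets \<mu>" for n using \<mu> by auto
    show "decseq (\<lambda>n. ball x (\<rho> n))"
      using dec by (auto simp: decseq_def intro!: subset_ball)
    show "emeasure \<mu> (\<Inter>n. ball x (\<rho> n)) = 0" using Int null by simp
    have "(\<integral>\<^sup>+y\<in>ball x (\<rho> 0). ?f y \<partial>\<mu>) \<le> (\<integral>\<^sup>+y\<in>ball x e. ?f y \<partial>\<mu>)"
      using \<rho>(2)[of 0] by (intro nn_integral_mono) (auto simp: indicator_def)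
    then show "(\<integral>\<^sup>+y\<in>ball x (\<rho> 0). ?f y \<partial>\<mu>) < \<infinity>" using fin by (rule le_less_trans)
  qed
  moreover have "ennreal C \<le> (\<integral>\<^sup>+y\<in>ball x (\<rho> n). ?f y \<partial>\<mu>)" if "\<eta> \<le> \<gamma>" for n
  proof -
    have "C * 1 \<le> C * \<rho> n powr (\<eta> - \<gamma>)"
      using \<rho>[of n] that \<open>0 < C\<close> powr_mono'[of "\<eta> - \<gamma>" 0 "\<rho> n"] by (intro mult_left_mono) auto
    also have "\<dots> = \<rho> n powr (-\<gamma>) * (C * \<rho> n powr \<eta>)"
      using \<rho>[of n] by (simp add: powr_add[symmetric])
    finally have "ennreal C \<le> ennreal (\<rho> n powr (-\<gamma>)) * ennreal (C * \<rho> n powr \<eta>)"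
      using \<open>0 < C\<close> by (simp add: ennreal_mult[symmetric] ennreal_leI)
    also have "\<dots> \<le> ennreal (\<rho> n powr (-\<gamma>)) * emeasure \<mu> (ball x (\<rho> n))"
      using lb \<rho>[of n] by (intro mult_left_mono) auto
    also have "\<dots> = (\<integral>\<^sup>+y. ennreal (\<rho> n powr (-\<gamma>)) * indicator (ball x (\<rho> n)) y \<partial>\<mu>)"
      using \<mu> by (subst nn_integral_cmult_indicator) auto
    also have "\<dots> \<le> (\<integral>\<^sup>+y\<in>ball x (\<rho> n). ?f y \<partial>\<mu>)"
      unfolding f_eq using \<gamma> by (intro nn_integral_mono)
        (auto simp: indicator_def intro!: ennreal_leI powr_mono2')
    finally show ?thesis .
  qed
  ultimately have "ennreal C \<le> 0" if "\<eta> \<le> \<gamma>"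
    using that by (intro LIMSEQ_le_const) auto
  then show ?thesis using \<open>0 < C\<close> by (force simp: \<gamma>_def ennreal_eq_0_iff)
qed

lemma class_K_subset_class_D: "class_K \<nu> \<beta> p \<subseteq> class_D \<nu> \<beta> p"
proof
  fix \<mu> :: "'a measure"
  assume K: "\<mu> \<in> class_K \<nu> \<beta> p"
  show "\<mu> \<in> class_D \<nu> \<beta> p"
  proof (cases "\<beta> \<le> \<nu>")
    case True
    let ?I = "\<lambda>r. SUP x. \<integral>\<^sup>+y\<in>ball x r. ennreal_powr (green \<nu> \<beta> (dist x y)) p \<partial>\<mu>"
    have "(?I \<longlongrightarrow> 0) (at_right 0)" using K True by (simp add: class_K_def)
    then have "\<forall>\<^sub>F r in at_right 0. ?I r < \<infinity>"
      by (rule order_tendstoD) simp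
    moreover have "\<forall>\<^sub>F r in at_right 0. 0 < r \<and> r < (1::real)"
      using eventually_at_right_real[of 0 "1::real"] by simp
    ultimately have "\<forall>\<^sub>F r in at_right 0. 0 < r \<and> r < 1 \<and> ?I r < \<infinity>"
      by eventually_elim auto
    then obtain r where "0 < r" "r < 1" "?I r < \<infinity>"
      using eventually_happens[of _ "at_right (0::real)"] by auto
    then show ?thesis using K True by (auto simp: class_K_def class_D_def)
  next
    case False
    then show ?thesis using K by (simp add: class_K_def class_D_def)
  qed
qed


section \<open>Lower volume bound from heat kernel estimates\<close>

text \<open>
  Both alternatives in the Bishop type inequality let the scale \<open>s\<close> be pulled out of \<open>V\<close> with
  the exponent \<open>\<nu>\<close>. The increasing case uses \<open>4 s \<le> 1\<close> and gives a multiple of \<open>V u\<close>; the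
  bounded case gives a multiple of \<open>u\<^sup>\<nu>\<close>. The maximum on the right is the one in the
  integrability condition on the upper profile. The factor \<open>4\<close> is the loss in \<open>tail_integral_le\<close>.
\<close>

lemma bishop_scaling:
  assumes bi: "bishop_inequality M \<nu> V"
  obtains K where "0 < K"
    "\<And>s u. 0 < s \<Longrightarrow> s \<le> 1/4 \<Longrightarrow> 0 < u \<Longrightarrow> V (4 * s * u) \<le> K * s powr \<nu> * max (V u) (u powr \<nu>)"
proof -
  let ?q = "\<lambda>r. V r / r powr \<nu>"
  have "\<exists>B>0. \<forall>s u. 0 < s \<longrightarrow> s \<le> 1/4 \<longrightarrow> 0 < u \<longrightarrow>
      ?q (4 * s * u) * u powr \<nu> \<le> B * max (V u) (u powr \<nu>)"
  proof (cases "mono_on {0<..} ?q")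
    case True
    have "?q (4 * s * u) * u powr \<nu> \<le> max (V u) (u powr \<nu>)"
      if "0 < s" "s \<le> 1/4" "0 < u" for s u
    proof -
      have "?q (4 * s * u) \<le> ?q u"
        using that by (intro mono_onD[OF True]) auto
      then have "?q (4 * s * u) * u powr \<nu> \<le> ?q u * u powr \<nu>"
        by (intro mult_right_mono) auto
      then show ?thesis using that by auto
    qed
    then show ?thesis by (intro exI[of _ 1]) auto
  next
    case False
    then obtain B where "B > 0" and B: "\<And>r. 0 < r \<Longrightarrow> \<bar>?q r\<bar> \<le> B"
      using bi by (auto simp: bishop_inequality_def bounded_pos)
    have "?q (4 * s * u) * u powr \<nu> \<le> B * max (V u) (u powr \<nu>)"
      if "0 < s" "s \<le> 1/4" "0 < u" for s u
    proof -
      have "?q (4 * s * u) \<le> B" using order_trans[OF abs_ge_self B[of "4 * s * u"]] that by simp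
      then have "?q (4 * s * u) * u powr \<nu> \<le> B * u powr \<nu>"
        by (intro mult_right_mono) auto
      also have "\<dots> \<le> B * max (V u) (u powr \<nu>)"
        using \<open>B > 0\<close> by (intro mult_left_mono) auto
      finally show ?thesis .
    qed
    then show ?thesis using \<open>B > 0\<close> by blast
  qed
  then obtain B where B: "B > 0" "\<And>s u. 0 < s \<Longrightarrow> s \<le> 1/4 \<Longrightarrow> 0 < u \<Longrightarrow>
      ?q (4 * s * u) * u powr \<nu> \<le> B * max (V u) (u powr \<nu>)" by blast
  show ?thesis
  proof (rule that[of "B * 4 powr \<nu>"])
    fix s u :: real assume su: "0 < s" "s \<le> 1/4" "0 < u"
    have "V (4 * s * u) = (4 powr \<nu> * s powr \<nu>) * (?q (4 * s * u) * u powr \<nu>)"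
      using su by (simp add: powr_mult)
    also have "\<dots> \<le> (4 powr \<nu> * s powr \<nu>) * (B * max (V u) (u powr \<nu>))"
      using B(2)[OF su] by (intro mult_left_mono) auto
    finally show "V (4 * s * u) \<le> B * 4 powr \<nu> * s powr \<nu> * max (V u) (u powr \<nu>)"
      by (simp add: mult_ac)
  qed (use B in auto)
qed

text \<open>
  The profiles and \<open>V\<close> are monotone on a half-line only, with arbitrary values elsewhere;
  integrals over the real line call for a globally measurable version.
\<close>

lemma mono_on_measurable_extension:
  fixes f :: "real \<Rightarrow> real"
  assumes "mono_on A f" "A \<in> sets borel"
  obtains g where "g \<in> borel_measurable borel" "\<And>t. t \<in> A \<Longrightarrow> g t = f t"
proof -
  have "(\<lambda>t. indicator A t *\<^sub>R f t) \<in> borel_measurable borel"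
    using borel_measurable_mono_on_fnc[OF assms(1)] assms(2)
    by (subst (asm) borel_measurable_restrict_space_iff) auto
  then show ?thesis by (rule that) simp
qed

lemma antimono_on_measurable_extension:
  fixes f :: "real \<Rightarrow> real"
  assumes "antimono_on A f" "A \<in> sets borel"
  obtains g where "g \<in> borel_measurable borel" "\<And>t. t \<in> A \<Longrightarrow> g t = f t"
proof -
  have "mono_on A (\<lambda>t. - f t)"
    using assms by (auto simp: monotone_on_def)
  then obtain g where g: "g \<in> borel_measurable borel" "\<And>t. t \<in> A \<Longrightarrow> g t = - f t"
    using assms mono_on_measurable_extension by blast
  show ?thesis
  proof (rule that[of "\<lambda>t. - g t"])
    show "(\<lambda>t. - g t) \<in> borel_measurable borel" using g(1) by measurable
  qed (simp add: g)
qed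

text \<open>
  A value of a decreasing profile is dominated by its average with respect to \<open>dt / t\<close> over the
  preceding octave. This brings in the integral over \<open>t\<close> of the integrability condition.
\<close>

lemma kernel_profile_le_average:
  fixes \<Phi> :: "real \<Rightarrow> real"
  assumes \<Phi>: "antimono_on {0..} \<Phi>" "\<forall>s\<ge>0. 0 < \<Phi> s" and a: "0 < a"
  shows "ennreal (\<Phi> (2 * a)) \<le> 2 * (\<integral>\<^sup>+t\<in>{a..2 * a}. ennreal (\<Phi> t / t) \<partial>lborel)"
proof -
  have "ennreal (\<Phi> (2 * a)) = 2 * (ennreal (\<Phi> (2 * a) / (2 * a)) * ennreal a)"
    using a \<Phi>(2) by (simp add: ennreal_mult[symmetric] ennreal_numeral[symmetric] less_imp_le del: ennreal_numeral)
  also have "ennreal (\<Phi> (2 * a) / (2 * a)) * ennreal a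
      = (\<integral>\<^sup>+t. ennreal (\<Phi> (2 * a) / (2 * a)) * indicator {a..2 * a} t \<partial>lborel)"
    using a by (subst nn_integral_cmult_indicator) auto
  also have "\<dots> \<le> (\<integral>\<^sup>+t\<in>{a..2 * a}. ennreal (\<Phi> t / t) \<partial>lborel)"
  proof (intro nn_integral_mono)
    fix t
    have "\<Phi> (2 * a) / (2 * a) \<le> \<Phi> t / t" if "a \<le> t" "t \<le> 2 * a"
      using that a \<Phi> monotone_onD[OF \<Phi>(1), of t "2 * a"]
      by (intro frac_le) (auto simp: less_imp_le)
    then show "ennreal (\<Phi> (2 * a) / (2 * a)) * indicator {a..2 * a} t
        \<le> ennreal (\<Phi> t / t) * indicator {a..2 * a} t"
      by (auto simp: indicator_def intro!: ennreal_leI)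
  qed
  finally show ?thesis by (simp add: mult_left_mono)
qed

text \<open>
  \<open>V\<close> need not be doubling: a sum over dyadic shells would pair the value of \<open>V\<close> at the outer
  radius of a shell with that of \<open>\<Phi>\<close> at the inner one, and the integral of \<open>V \<Phi> / t\<close> over the shell
  does not control this product. Averaging \<open>\<Phi>\<close> over the preceding octave and applying Tonelli's
  theorem moves the loss into the argument \<open>4 s t\<close> of \<open>V\<close>, where smallness of \<open>s\<close> compensates
  for it.
\<close>

lemma tail_integral_le:
  fixes M :: "'a::{metric_space, second_countable_topology} measure" and \<Phi> V :: "real \<Rightarrow> real"
  assumes M[measurable_cong]: "sets M = sets borel"
    and V: "\<And>x r. 0 < r \<Longrightarrow> emeasure M (ball x r) \<le> ennreal (V r)"
    and \<Phi>: "antimono_on {0..} \<Phi>" "\<forall>s\<ge>0. 0 < \<Phi> s" and s: "0 < s" and r: "0 < r"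
  shows "(\<integral>\<^sup>+w\<in>- ball z r. ennreal (\<Phi> (dist z w / s)) \<partial>M)
    \<le> 2 * (\<integral>\<^sup>+t\<in>{r / (2 * s)..}. ennreal (V (4 * s * t) * (\<Phi> t / t)) \<partial>lborel)"
proof -
  let ?g = "\<lambda>t. ennreal (\<Phi> t / t) * indicator {r / (2 * s)..} t"
  have pos: "0 < r / (2 * s)" using r s by simp
  have g[measurable]: "?g \<in> borel_measurable borel"
  proof -
    obtain \<Phi>' where [measurable]: "\<Phi>' \<in> borel_measurable borel" and "\<And>t. 0 \<le> t \<Longrightarrow> \<Phi>' t = \<Phi> t"
      using antimono_on_measurable_extension[OF \<Phi>(1)] by auto
    then have "?g = (\<lambda>t. ennreal (\<Phi>' t / t) * indicator {r / (2 * s)..} t)"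
      using pos by (auto simp: indicator_def fun_eq_iff)
    also have "\<dots> \<in> borel_measurable borel" by measurable
    finally show ?thesis .
  qed
  interpret M: sigma_finite_measure M
  proof
    have "(\<Union>n. ball z (real (Suc n))) = UNIV"
    proof -
      have "\<exists>n. dist z w < real (Suc n)" for w
        using reals_Archimedean2[of "dist z w"] by (meson lessI less_trans of_nat_less_iff)
      then show ?thesis by auto
    qed
    moreover have "emeasure M (ball z (real (Suc n))) \<noteq> \<infinity>" for n
      using V[of "real (Suc n)" z] by (auto simp: top_unique)
    ultimately show "\<exists>A. countable A \<and> A \<subseteq> sets M \<and> \<Union> A = space M \<and> (\<forall>a\<in>A. emeasure M a \<noteq> \<infinity>)"
      using M sets_eq_imp_space_eq[OF M]
      by (intro exI[of _ "range (\<lambda>n. ball z (real (Suc n)))"]) auto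
  qed
  interpret pair_sigma_finite M lborel ..
  have "(\<integral>\<^sup>+w\<in>- ball z r. ennreal (\<Phi> (dist z w / s)) \<partial>M)
      \<le> (\<integral>\<^sup>+w. 2 * (\<integral>\<^sup>+t. ?g t * indicator {w. dist z w < 4 * s * t} w \<partial>lborel) \<partial>M)"
  proof (intro nn_integral_mono)
    fix w
    show "ennreal (\<Phi> (dist z w / s)) * indicator (- ball z r) w
        \<le> 2 * (\<integral>\<^sup>+t. ?g t * indicator {w. dist z w < 4 * s * t} w \<partial>lborel)"
    proof (cases "dist z w < r")
      case False
      \<comment> \<open>the octave from \<open>a\<close> ends at the argument of \<open>\<Phi>\<close>\<close>
      define a where "a = dist z w / (2 * s)"
      have a: "0 < a" "r / (2 * s) \<le> a" "dist z w / s = 2 * a" "dist z w = 2 * s * a"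
        using False r s by (auto simp: a_def not_less intro!: divide_right_mono divide_pos_pos)
      have "ennreal (\<Phi> (2 * a)) \<le> 2 * (\<integral>\<^sup>+t\<in>{a..2 * a}. ennreal (\<Phi> t / t) \<partial>lborel)"
        using \<Phi> a by (intro kernel_profile_le_average) auto
      also have "\<dots> \<le> 2 * (\<integral>\<^sup>+t. ?g t * indicator {w. dist z w < 4 * s * t} w \<partial>lborel)"
      proof (intro mult_left_mono nn_integral_mono)
        fix t
        have "2 * s * a < 4 * s * t" if "a \<le> t"
          using that a(1) s mult_left_mono[of a t s] mult_pos_pos[of s a] by linarith
        then show "ennreal (\<Phi> t / t) * indicator {a..2 * a} t
            \<le> ?g t * indicator {w. dist z w < 4 * s * t} w"
          using a by (auto simp: indicator_def)
      qed auto
      finally show ?thesis using False a by simp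
    qed auto
  qed
  also have "\<dots> = 2 * (\<integral>\<^sup>+w. (\<integral>\<^sup>+t. ?g t * indicator {w. dist z w < 4 * s * t} w \<partial>lborel) \<partial>M)"
    by (rule nn_integral_cmult) measurable
  also have "(\<integral>\<^sup>+w. (\<integral>\<^sup>+t. ?g t * indicator {w. dist z w < 4 * s * t} w \<partial>lborel) \<partial>M)
      = (\<integral>\<^sup>+t. (\<integral>\<^sup>+w. ?g t * indicator {w. dist z w < 4 * s * t} w \<partial>M) \<partial>lborel)"
    by (rule Fubini'[symmetric]) measurable
  also have "\<dots> \<le> (\<integral>\<^sup>+t\<in>{r / (2 * s)..}. ennreal (V (4 * s * t) * (\<Phi> t / t)) \<partial>lborel)"
  proof (intro nn_integral_mono)
    fix t
    have b: "{w. dist z w < 4 * s * t} = ball z (4 * s * t)" by (auto simp: ball_def)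
    have "(\<integral>\<^sup>+w. ?g t * indicator {w. dist z w < 4 * s * t} w \<partial>M)
        = ?g t * emeasure M (ball z (4 * s * t))"
      unfolding b using M by (intro nn_integral_cmult_indicator) auto
    also have "\<dots> \<le> ennreal (V (4 * s * t) * (\<Phi> t / t)) * indicator {r / (2 * s)..} t"
    proof (cases "r / (2 * s) \<le> t")
      case True
      then have t: "0 < t" using pos by linarith
      have \<Phi>t: "0 \<le> \<Phi> t / t" using t \<Phi>(2) by (simp add: less_imp_le)
      have "ennreal (\<Phi> t / t) * emeasure M (ball z (4 * s * t))
          \<le> ennreal (\<Phi> t / t) * ennreal (V (4 * s * t))"
        using V s t by (intro mult_left_mono) auto
      also have "\<dots> = ennreal (V (4 * s * t) * (\<Phi> t / t))"
        by (subst ennreal_mult''[OF \<Phi>t]) (rule mult.commute)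
      finally show ?thesis using True by simp
    qed auto
    finally show "(\<integral>\<^sup>+w. ?g t * indicator {w. dist z w < 4 * s * t} w \<partial>M)
        \<le> ennreal (V (4 * s * t) * (\<Phi> t / t)) * indicator {r / (2 * s)..} t" .
  qed
  finally show ?thesis by (simp add: mult_left_mono)
qed


text \<open>
  The radius \<open>r\<close> is fixed and the time \<open>t = s\<^sup>\<beta>\<close> is taken small. The diagonal value of the kernel
  at time \<open>2 t\<close> is at least a constant times \<open>s\<close> to the power \<open>-\<nu>\<close>. In its Chapman-Kolmogorov
  integral one factor is replaced by its maximal bound and the other is integrated. By
  \<open>tail_integral_le\<close> and \<open>bishop_scaling\<close>, the part outside the ball is at most half of that lower
  bound once \<open>r / (2 s)\<close> is so large that the integrability condition leaves a small remainder. The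
  other half must come from the ball, whatever its centre.
\<close>

lemma volume_lower_bound:
  fixes M :: "'a::{metric_space, second_countable_topology} measure"
  assumes M: "sets M = sets borel" and "0 < \<beta>" "0 < t\<^sub>0"
    and V: "mono_on {0<..} V" and bi: "bishop_inequality M \<nu> V"
    and hke: "heat_kernel_estimates \<nu> \<beta> t\<^sub>0 V k"
    and k_nonneg: "\<And>t x y. 0 < t \<Longrightarrow> 0 \<le> k t x y"
    and chapman: "\<And>s t x y. 0 < s \<Longrightarrow> 0 < t \<Longrightarrow>
      ennreal (k (t + s) x y) = (\<integral>\<^sup>+z. ennreal (k s x z * k t z y) \<partial>M)"
    and r: "0 < r"
  obtains c where "0 < c" "\<And>z. ennreal c \<le> emeasure M (ball z r)"
proof -
  have MV: "emeasure M (ball x e) \<le> ennreal (V e)" if "0 < e" for x e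
    using bi that unfolding bishop_inequality_def by (meson SUP_upper UNIV_I order_trans)
  obtain \<Phi>\<^sub>1 \<Phi>\<^sub>2 :: "real \<Rightarrow> real" where
    \<Phi>1: "0 < \<Phi>\<^sub>1 0" and
    \<Phi>2: "antimono_on {0..} \<Phi>\<^sub>2" "\<forall>s\<ge>0. 0 < \<Phi>\<^sub>2 s" and
    int: "(\<integral>\<^sup>+t\<in>{1..}. ennreal (max (V t) (t powr \<nu>) * \<Phi>\<^sub>2 t / t) \<partial>lborel) < \<infinity>" and
    est: "\<And>x y t. 0 < t \<Longrightarrow> ereal t < t\<^sub>0 \<Longrightarrow>
           1 / t powr (\<nu> / \<beta>) * \<Phi>\<^sub>1 (dist x y / t powr (1 / \<beta>)) \<le> k t x y \<and>
           k t x y \<le> 1 / t powr (\<nu> / \<beta>) * \<Phi>\<^sub>2 (dist x y / t powr (1 / \<beta>))"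
    using hke unfolding heat_kernel_estimates_def by auto
  obtain \<delta> where \<delta>: "0 < \<delta>" "ereal \<delta> < t\<^sub>0"
    using ereal_dense2[OF \<open>0 < t\<^sub>0\<close>] by auto
  obtain K where K: "0 < K" "\<And>s u. 0 < s \<Longrightarrow> s \<le> 1/4 \<Longrightarrow> 0 < u \<Longrightarrow>
      V (4 * s * u) \<le> K * s powr \<nu> * max (V u) (u powr \<nu>)"
    using bishop_scaling[OF bi] by blast
  obtain V' where [measurable]: "V' \<in> borel_measurable borel" and V': "\<And>t. 0 < t \<Longrightarrow> V' t = V t"
    using mono_on_measurable_extension[OF V] by auto
  obtain \<Phi>' where [measurable]: "\<Phi>' \<in> borel_measurable borel"
    and \<Phi>': "\<And>t. 0 \<le> t \<Longrightarrow> \<Phi>' t = \<Phi>\<^sub>2 t"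
    using antimono_on_measurable_extension[OF \<Phi>2(1)] by auto
  define A where "A = \<Phi>\<^sub>2 0"
  define b where "b = \<Phi>\<^sub>1 0 / 2 powr (\<nu> / \<beta>)"
  have A: "0 < A" and b: "0 < b" using \<Phi>1 \<Phi>2 by (auto simp: A_def b_def)
  define H where "H t = ennreal (max (V t) (t powr \<nu>) * \<Phi>\<^sub>2 t / t)" for t
  \<comment> \<open>chosen so that the part outside the ball takes exactly half of the lower bound\<close>
  define \<epsilon> where "\<epsilon> = b / (4 * A * K)"
  have \<epsilon>: "0 < \<epsilon>" using A b K by (simp add: \<epsilon>_def)
  obtain T where T: "1 \<le> T" "(\<integral>\<^sup>+t\<in>{T..}. H t \<partial>lborel) < ennreal \<epsilon>"
  proof -
    let ?H = "\<lambda>t. H t * indicator {1..} t"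
    have "?H = (\<lambda>t. ennreal (max (V' t) (t powr \<nu>) * \<Phi>' t / t) * indicator {1..} t)"
      by (auto simp: H_def V' \<Phi>' indicator_def fun_eq_iff)
    also have "\<dots> \<in> borel_measurable lborel" by measurable
    finally have "(\<lambda>n. \<integral>\<^sup>+t\<in>{real (Suc n)..}. ?H t \<partial>lborel) \<longlonglongrightarrow> 0"
    proof (rule nn_integral_decseq_tendsto_0)
      show "decseq (\<lambda>n. {real (Suc n)..})" by (auto simp: decseq_def)
      have "(\<Inter>n. {real (Suc n)..}) = {}"
      proof -
        have "\<exists>n. x < real (Suc n)" for x :: real
          using reals_Archimedean2[of x] by (meson lessI less_trans of_nat_less_iff)
        then show ?thesis by (force simp: not_le[symmetric])
      qed
      then show "emeasure lborel (\<Inter>n. {real (Suc n)..}) = 0" by simp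
      show "(\<integral>\<^sup>+t\<in>{real (Suc 0)..}. ?H t \<partial>lborel) < \<infinity>"
        using int by (simp add: H_def mult.assoc flip: indicator_inter_arith)
    qed auto
    then have "\<forall>\<^sub>F n in sequentially. (\<integral>\<^sup>+t\<in>{real (Suc n)..}. ?H t \<partial>lborel) < ennreal \<epsilon>"
      by (rule order_tendstoD) (simp add: \<epsilon>)
    then obtain n where n: "(\<integral>\<^sup>+t\<in>{real (Suc n)..}. ?H t \<partial>lborel) < ennreal \<epsilon>"
      by (auto dest: eventually_happens)
    have "?H t * indicator {real (Suc n)..} t = H t * indicator {real (Suc n)..} t" for t
      by (auto simp: indicator_def)
    then show ?thesis using that[of "real (Suc n)"] n by simp
  qed
  \<comment> \<open>the three constraints: \<open>bishop_scaling\<close> applies, \<open>r / (2 s) \<ge> T\<close>, and \<open>2 t < t\<^sub>0\<close>\<close>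
  define s where "s = min (min (1/4) (r / (2 * T))) ((\<delta> / 4) powr (1 / \<beta>))"
  have s: "0 < s" "s \<le> 1/4" "s \<le> r / (2 * T)" "s \<le> (\<delta> / 4) powr (1 / \<beta>)"
    using r T \<delta> by (auto simp: s_def)
  have Ts: "T \<le> r / (2 * s)" using s T by (simp add: field_simps)
  define t where "t = s powr \<beta>"
  have t: "0 < t" "t powr (1 / \<beta>) = s" "t powr (\<nu> / \<beta>) = s powr \<nu>"
    using s \<open>0 < \<beta>\<close> by (auto simp: t_def powr_powr)
  have "t \<le> ((\<delta> / 4) powr (1 / \<beta>)) powr \<beta>"
    unfolding t_def using s \<open>0 < \<beta>\<close> by (intro powr_mono2) auto
  also have "\<dots> = \<delta> / 4" using \<delta> \<open>0 < \<beta>\<close> by (simp add: powr_powr)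
  finally have "t < \<delta>" "t + t < \<delta>" using \<delta> by auto
  then have t0: "ereal t < t\<^sub>0" "ereal (t + t) < t\<^sub>0"
    using \<delta>(2) by (auto intro: less_trans[of _ "ereal \<delta>"])
  define S where "S = s powr \<nu>"
  have S: "0 < S" using s by (simp add: S_def)
  have tail: "(\<integral>\<^sup>+w\<in>- ball z r. ennreal (\<Phi>\<^sub>2 (dist z w / s)) \<partial>M) \<le> ennreal (b * S / (2 * A))" for z
  proof -
    have "(\<integral>\<^sup>+w\<in>- ball z r. ennreal (\<Phi>\<^sub>2 (dist z w / s)) \<partial>M)
        \<le> 2 * (\<integral>\<^sup>+u\<in>{r / (2 * s)..}. ennreal (V (4 * s * u) * (\<Phi>\<^sub>2 u / u)) \<partial>lborel)"
      using M MV \<Phi>2 s r by (intro tail_integral_le) auto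
    also have "\<dots> \<le> 2 * (\<integral>\<^sup>+u. ennreal (K * S) * (H u * indicator {T..} u) \<partial>lborel)"
    proof (intro mult_left_mono nn_integral_mono)
      fix u
      show "ennreal (V (4 * s * u) * (\<Phi>\<^sub>2 u / u)) * indicator {r / (2 * s)..} u
          \<le> ennreal (K * S) * (H u * indicator {T..} u)"
      proof (cases "r / (2 * s) \<le> u")
        case True
        then have u: "0 < u" "T \<le> u" using Ts T by auto
        have "V (4 * s * u) * (\<Phi>\<^sub>2 u / u) \<le> (K * S * max (V u) (u powr \<nu>)) * (\<Phi>\<^sub>2 u / u)"
          using K(2)[of s u] s u \<Phi>2(2) by (intro mult_right_mono) (auto simp: S_def less_imp_le)
        also have "\<dots> = (K * S) * (max (V u) (u powr \<nu>) * \<Phi>\<^sub>2 u / u)" by simp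
        finally have "ennreal (V (4 * s * u) * (\<Phi>\<^sub>2 u / u)) \<le> ennreal (K * S) * H u"
          using K S by (simp add: H_def ennreal_mult'[symmetric] ennreal_leI)
        then show ?thesis using True u by simp
      qed auto
    qed auto
    also have "(\<integral>\<^sup>+u. ennreal (K * S) * (H u * indicator {T..} u) \<partial>lborel)
        = ennreal (K * S) * (\<integral>\<^sup>+u\<in>{T..}. H u \<partial>lborel)"
    proof (rule nn_integral_cmult)
      have "(\<lambda>u. H u * indicator {T..} u) = (\<lambda>t. ennreal (max (V' t) (t powr \<nu>) * \<Phi>' t / t) * indicator {T..} t)"
        using T by (auto simp: H_def V' \<Phi>' indicator_def fun_eq_iff)
      also have "\<dots> \<in> borel_measurable lborel" by measurable
      finally show "(\<lambda>u. H u * indicator {T..} u) \<in> borel_measurable lborel" .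
    qed
    also have "2 * (ennreal (K * S) * (\<integral>\<^sup>+u\<in>{T..}. H u \<partial>lborel))
        \<le> 2 * (ennreal (K * S) * ennreal \<epsilon>)"
      using T by (intro mult_left_mono) auto
    also have "\<dots> = ennreal (2 * (K * S * \<epsilon>))"
      using K S \<epsilon> by (simp add: ennreal_mult)
    also have "2 * (K * S * \<epsilon>) = b * S / (2 * A)"
      using K A by (simp add: \<epsilon>_def field_simps)
    finally show ?thesis .
  qed
  have lower: "ennreal (b * S / (2 * A\<^sup>2)) \<le> emeasure M (ball z r)" for z
  proof (rule ccontr)
    assume "\<not> ?thesis"
    then obtain v where v: "0 \<le> v" "emeasure M (ball z r) = ennreal v" "v < b * S / (2 * A\<^sup>2)"
      by (cases "emeasure M (ball z r)") (auto simp: not_le ennreal_less_iff top_unique)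
    have [measurable]: "(\<lambda>w. ennreal (\<Phi>\<^sub>2 (dist z w / s))) \<in> borel_measurable M"
    proof -
      have "(\<lambda>w. ennreal (\<Phi>' (dist z w / s))) \<in> borel_measurable borel" by measurable
      then show ?thesis using s M by (simp add: \<Phi>' cong: measurable_cong_sets)
    qed
    have [measurable]: "ball z r \<in> sets M" "- ball z r \<in> sets M" using M by auto
    have "ennreal (b / S) \<le> ennreal (k (t + t) z z)"
    proof (rule ennreal_leI)
      have "(t + t) powr (\<nu> / \<beta>) = 2 powr (\<nu> / \<beta>) * S"
        using t powr_mult[of 2 t "\<nu> / \<beta>"] by (simp add: S_def)
      then show "b / S \<le> k (t + t) z z"
        using est[of "t + t" z z] t t0 by (simp add: b_def)
    qed
    also have "\<dots> = (\<integral>\<^sup>+w. ennreal (k t z w * k t w z) \<partial>M)"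
      using chapman t by blast
    also have "\<dots> \<le> (\<integral>\<^sup>+w. ennreal (A / S\<^sup>2) * (ennreal A * indicator (ball z r) w
        + ennreal (\<Phi>\<^sub>2 (dist z w / s)) * indicator (- ball z r) w) \<partial>M)"
    proof (intro nn_integral_mono)
      fix w
      let ?d = "dist z w / s"
      have d: "0 \<le> ?d" using s by simp
      have \<Phi>A: "\<Phi>\<^sub>2 ?d \<le> A"
        using monotone_onD[OF \<Phi>2(1), of 0 ?d] d by (simp add: A_def)
      have kb: "k t z w \<le> \<Phi>\<^sub>2 ?d / S" "k t w z \<le> \<Phi>\<^sub>2 ?d / S"
        using est[of t z w] est[of t w z] t t0 by (auto simp: S_def dist_commute)
      have "k t w z \<le> A / S"
        using kb(2) \<Phi>A S by (meson divide_right_mono less_imp_le order_trans)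
      with kb(1) have "k t z w * k t w z \<le> \<Phi>\<^sub>2 ?d / S * (A / S)"
        using k_nonneg t A S \<Phi>2(2) d by (intro mult_mono) (auto simp: less_imp_le)
      also have "\<dots> = A / S\<^sup>2 * \<Phi>\<^sub>2 ?d" by (simp add: power2_eq_square)
      finally have "ennreal (k t z w * k t w z) \<le> ennreal (A / S\<^sup>2) * ennreal (\<Phi>\<^sub>2 ?d)"
        using A \<Phi>2(2) d by (simp add: ennreal_mult[symmetric] ennreal_leI less_imp_le)
      also have "\<dots> \<le> ennreal (A / S\<^sup>2) * (ennreal A * indicator (ball z r) w
          + ennreal (\<Phi>\<^sub>2 ?d) * indicator (- ball z r) w)"
        using \<Phi>A by (intro mult_left_mono) (auto simp: indicator_def ennreal_leI)
      finally show "ennreal (k t z w * k t w z) \<le> \<dots>" .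
    qed
    also have "\<dots> = ennreal (A / S\<^sup>2) * (ennreal A * emeasure M (ball z r)
        + (\<integral>\<^sup>+w\<in>- ball z r. ennreal (\<Phi>\<^sub>2 (dist z w / s)) \<partial>M))"
      by (simp add: nn_integral_cmult nn_integral_add nn_integral_cmult_indicator)
    also have "\<dots> \<le> ennreal (A / S\<^sup>2) * (ennreal A * ennreal v + ennreal (b * S / (2 * A)))"
      using tail v by (intro mult_left_mono add_mono) auto
    also have "\<dots> = ennreal (A / S\<^sup>2 * (A * v + b * S / (2 * A)))"
      using A b S v by (simp add: ennreal_mult[symmetric] ennreal_plus[symmetric] del: ennreal_plus)
    finally have "b / S \<le> A / S\<^sup>2 * (A * v + b * S / (2 * A))"
      using A b S v by (subst (asm) ennreal_le_iff) auto
    then have "b / S * S\<^sup>2 \<le> A / S\<^sup>2 * (A * v + b * S / (2 * A)) * S\<^sup>2"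
      using S by (intro mult_right_mono) auto
    then have "b * S \<le> A\<^sup>2 * v + b * S / 2"
      using S A by (simp add: power2_eq_square field_simps)
    moreover have "A\<^sup>2 * v < b * S / 2"
      using v(3) A by (simp add: field_simps)
    ultimately show False by linarith
  qed
  show ?thesis using that[OF _ lower] A b S by simp
qed


section \<open>Covering unit balls by small balls\<close>

text \<open>
  Balls of radius \<open>r / 2\<close> about an \<open>r\<close>-separated subset of the unit ball are disjoint and lie in
  the ball of radius \<open>2\<close>, which bounds the cardinality. A separated set of maximal cardinality is an
  \<open>r\<close>-net.
\<close>

lemma cball_cover_by_packing:
  fixes M :: "'a::metric_space measure"
  assumes M: "sets M = sets borel" and r: "0 < r" "r \<le> 2" and c: "0 < c" and v: "0 \<le> v"
    and lb: "\<And>z. ennreal c \<le> emeasure M (ball z (r / 2))"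
    and ub: "emeasure M (ball x 2) \<le> ennreal v"
  obtains S where "finite S" "real (card S) \<le> v / c" "cball x 1 \<subseteq> (\<Union>z\<in>S. ball z r)"
proof -
  define sep where
    "sep S \<longleftrightarrow> finite S \<and> S \<subseteq> cball x 1 \<and> pairwise (\<lambda>y z. r \<le> dist y z) S" for S
  have bound: "real (card S) \<le> v / c" if S: "sep S" for S
  proof -
    have fin: "finite S" using S by (simp add: sep_def)
    have "ennreal (real (card S) * c) = (\<Sum>z\<in>S. ennreal c)"
      using c by (simp add: ennreal_mult ennreal_of_nat_eq_real_of_nat)
    also have "\<dots> \<le> (\<Sum>z\<in>S. emeasure M (ball z (r / 2)))" by (intro sum_mono lb)
    also have "\<dots> = emeasure M (\<Union>z\<in>S. ball z (r / 2))"
    proof (rule sum_emeasure)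
      show "disjoint_family_on (\<lambda>z. ball z (r / 2)) S"
        unfolding disjoint_family_on_def
      proof (intro ballI impI equals0I)
        fix y z w assume yz: "y \<in> S" "z \<in> S" "y \<noteq> z" and w: "w \<in> ball y (r / 2) \<inter> ball z (r / 2)"
        have "r \<le> dist y z" using S yz by (auto simp: sep_def pairwise_def)
        also have "\<dots> \<le> dist y w + dist z w" by (rule dist_triangle2)
        also have "\<dots> < r" using w by auto
        finally show False by simp
      qed
      show "(\<lambda>z. ball z (r / 2)) ` S \<subseteq> sets M" unfolding M by (intro image_subsetI borel_open open_ball)
    qed (rule fin)
    also have "\<dots> \<le> emeasure M (ball x 2)"
    proof (rule emeasure_mono)
      show "(\<Union>z\<in>S. ball z (r / 2)) \<subseteq> ball x 2"
      proof clarify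
        fix z w assume z: "z \<in> S" and w: "w \<in> ball z (r / 2)"
        have "dist x w \<le> dist x z + dist z w" by (rule dist_triangle)
        then show "w \<in> ball x 2" using S z w r by (auto simp: sep_def subset_iff)
      qed
    qed (use M in auto)
    also have "\<dots> \<le> ennreal v" by (rule ub)
    finally show ?thesis using c v by (simp add: field_simps)
  qed
  have "\<exists>S. sep S \<and> (\<forall>S'. sep S' \<longrightarrow> card S' \<le> card S)"
  proof (rule ex_has_greatest_nat)
    show "sep {}" by (simp add: sep_def)
    show "\<forall>S. sep S \<longrightarrow> card S < Suc (nat \<lfloor>v / c\<rfloor>)"
      using bound by (auto simp: less_Suc_eq_le le_nat_floor)
  qed
  then obtain S where S: "sep S" "\<And>S'. sep S' \<Longrightarrow> card S' \<le> card S" by blast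
  have "cball x 1 \<subseteq> (\<Union>z\<in>S. ball z r)"
  proof (rule ccontr)
    assume "\<not> ?thesis"
    then obtain w where w: "w \<in> cball x 1" "\<And>z. z \<in> S \<Longrightarrow> r \<le> dist z w" by force
    have "w \<notin> S" using w(2)[of w] r by auto
    moreover have "sep (insert w S)"
      using S(1) w by (auto simp: sep_def pairwise_insert dist_commute)
    ultimately have "Suc (card S) \<le> card S"
      using S(1) S(2)[of "insert w S"] by (simp add: sep_def)
    then show False by simp
  qed
  then show ?thesis using that[of S] S(1) bound by (auto simp: sep_def)
qed

lemma SUP_emeasure_cball_finite:
  fixes M \<mu> :: "'a::metric_space measure"
  assumes M: "sets M = sets borel" and \<mu>: "sets \<mu> = sets borel"
    and lb: "\<And>r. 0 < r \<Longrightarrow> \<exists>c>0. \<forall>z. ennreal c \<le> emeasure M (ball z r)"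
    and ub: "\<And>x. emeasure M (ball x 2) \<le> ennreal v"
    and R: "0 < R" and \<mu>_ub: "\<And>x r. 0 < r \<Longrightarrow> r \<le> R \<Longrightarrow> emeasure \<mu> (ball x r) \<le> ennreal (a r)"
  shows "(SUP x. emeasure \<mu> (cball x 1)) < \<infinity>"
proof -
  define r where "r = min R 2"
  have r: "0 < r" "r \<le> 2" "r \<le> R" using R by (auto simp: r_def)
  obtain c where c: "0 < c" "\<And>z. ennreal c \<le> emeasure M (ball z (r / 2))"
    using lb[of "r / 2"] r by auto
  define B where "B = max v 0 / c"
  have "emeasure \<mu> (cball x 1) \<le> ennreal B * ennreal (a r)" for x
  proof -
    have "emeasure M (ball x 2) \<le> ennreal (max v 0)" using ub[of x] by (rule order_trans) (simp add: ennreal_leI)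
    then obtain S where S: "finite S" "real (card S) \<le> B" "cball x 1 \<subseteq> (\<Union>z\<in>S. ball z r)"
      using cball_cover_by_packing[OF M r(1,2) c(1) _ c(2), of "max v 0" x] by (auto simp: B_def)
    have "emeasure \<mu> (cball x 1) \<le> emeasure \<mu> (\<Union>z\<in>S. ball z r)"
      using S \<mu> by (intro emeasure_mono) auto
    also have "\<dots> \<le> (\<Sum>z\<in>S. emeasure \<mu> (ball z r))"
      using S \<mu> by (intro emeasure_subadditive_finite) auto
    also have "\<dots> \<le> (\<Sum>z\<in>S. ennreal (a r))" using \<mu>_ub r by (intro sum_mono) auto
    also have "\<dots> = ennreal (real (card S)) * ennreal (a r)"
      by (simp add: ennreal_of_nat_eq_real_of_nat)
    also have "\<dots> \<le> ennreal B * ennreal (a r)"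
      using S by (intro mult_right_mono ennreal_leI) auto
    finally show ?thesis .
  qed
  then have "(SUP x. emeasure \<mu> (cball x 1)) \<le> ennreal B * ennreal (a r)" by (rule SUP_least)
  also have "\<dots> < \<infinity>" by (simp add: ennreal_mult_less_top)
  finally show ?thesis .
qed


section \<open>Regularity of measures and the Kato and Dynkin classes\<close>

theorem theorem3p2:
  fixes m \<mu> :: "'a::{metric_space, second_countable_topology} measure"
    and \<E> :: "('a \<Rightarrow> real) \<Rightarrow> ('a \<Rightarrow> real) \<Rightarrow> real" and F :: "('a \<Rightarrow> real) set"
    and W :: "'w measure" and X :: "ennreal \<Rightarrow> 'w \<Rightarrow> 'a option" and P :: "'a option \<Rightarrow> 'w measure"
    and k :: "real \<Rightarrow> 'a \<Rightarrow> 'a \<Rightarrow> real"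
    and \<nu> \<beta> p \<eta> :: real and t\<^sub>0 :: ereal and V :: "real \<Rightarrow> real"
  assumes "locally_compact_space (euclidean :: 'a topology)"
    and "radon_measure m" and "full_support m"
    and "regular_dirichlet_form m \<E> F"
    and "hunt_process W X P" and "associated m \<E> F X P"
    and "semigroup_kernel m X P k"
    and "0 < \<nu>" and "0 < \<beta>" and "0 < t\<^sub>0"
    and "mono_on {0<..} V" and "\<forall>r>0. 0 < V r"
    and "bishop_inequality m \<nu> V"
    and "heat_kernel_estimates \<nu> \<beta> t\<^sub>0 V k"
    and "radon_measure \<mu>"
    and "1 \<le> p" and "0 < \<eta>" and "\<eta> \<le> \<nu>"
  shows
    "((\<exists>r\<^sub>0>0. \<exists>C\<^sub>2>0. \<forall>x. \<forall>r. 0 < r \<and> r \<le> r\<^sub>0 \<longrightarrow>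
          emeasure \<mu> (ball x r) \<le> ennreal (C\<^sub>2 * r powr \<eta>))
       \<and> \<eta> - p * (\<nu> - \<beta>) > 0 \<longrightarrow> \<mu> \<in> class_K \<nu> \<beta> p)
     \<and>
     ((\<exists>x\<^sub>0. \<exists>r\<^sub>0>0. \<exists>C\<^sub>1>0. \<forall>r. 0 < r \<and> r \<le> r\<^sub>0 \<longrightarrow>
          ennreal (C\<^sub>1 * r powr \<eta>) \<le> emeasure \<mu> (ball x\<^sub>0 r))
       \<and> \<mu> \<in> class_D \<nu> \<beta> p \<longrightarrow> \<eta> - p * (\<nu> - \<beta>) \<ge> 0)
     \<and>
     ((\<exists>x\<^sub>0. \<exists>r\<^sub>0>0. \<exists>C\<^sub>1>0. \<exists>C\<^sub>2>0. \<forall>r. 0 < r \<and> r \<le> r\<^sub>0 \<longrightarrow>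
          ennreal (C\<^sub>1 * r powr \<eta>) \<le> emeasure \<mu> (ball x\<^sub>0 r) \<and>
          emeasure \<mu> (ball x\<^sub>0 r) \<le> ennreal (C\<^sub>2 * r powr \<eta>))
       \<and> \<mu> \<in> class_D \<nu> \<beta> p \<longrightarrow> \<eta> - p * (\<nu> - \<beta>) > 0)
     \<and>
     ((\<exists>r\<^sub>0>0. \<exists>C\<^sub>1>0. \<exists>C\<^sub>2>0. \<forall>x. \<forall>r. 0 < r \<and> r \<le> r\<^sub>0 \<longrightarrow>
          ennreal (C\<^sub>1 * r powr \<eta>) \<le> emeasure \<mu> (ball x r) \<and>
          emeasure \<mu> (ball x r) \<le> ennreal (C\<^sub>2 * r powr \<eta>))
       \<longrightarrow> (\<mu> \<in> class_K \<nu> \<beta> p \<longleftrightarrow> \<mu> \<in> class_D \<nu> \<beta> p)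
         \<and> (\<mu> \<in> class_D \<nu> \<beta> p \<longleftrightarrow> \<eta> - p * (\<nu> - \<beta>) > 0))"
proof -
  let ?ub = "\<lambda>x R C. \<forall>r. 0 < r \<and> r \<le> R \<longrightarrow> emeasure \<mu> (ball x r) \<le> ennreal (C * r powr \<eta>)"
  let ?lb = "\<lambda>x R C. \<forall>r. 0 < r \<and> r \<le> R \<longrightarrow> ennreal (C * r powr \<eta>) \<le> emeasure \<mu> (ball x r)"
  have m: "sets m = sets borel" and \<mu>: "sets \<mu> = sets borel"
    using assms by (auto simp: radon_measure_def)
  have "\<exists>c>0. \<forall>z. ennreal c \<le> emeasure m (ball z r)" if "0 < r" for r
    using volume_lower_bound[OF m \<open>0 < \<beta>\<close> \<open>0 < t\<^sub>0\<close> \<open>mono_on {0<..} V\<close>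
        \<open>bishop_inequality m \<nu> V\<close> \<open>heat_kernel_estimates \<nu> \<beta> t\<^sub>0 V k\<close> _ _ that]
      \<open>semigroup_kernel m X P k\<close>
    unfolding semigroup_kernel_def by metis
  moreover have "emeasure m (ball x 2) \<le> ennreal (V 2)" for x
  proof -
    have "(SUP x. emeasure m (ball x 2)) \<le> ennreal (V 2)"
      using \<open>bishop_inequality m \<nu> V\<close> by (simp add: bishop_inequality_def)
    then show ?thesis by (meson SUP_upper UNIV_I order_trans)
  qed
  ultimately have K: "\<mu> \<in> class_K \<nu> \<beta> p"
    if "0 < R" "0 < C" "\<forall>x. ?ub x R C" "p * (\<nu> - \<beta>) < \<eta>" for R C
  proof (cases "\<beta> \<le> \<nu>")
    case True
    then show ?thesis
      using class_K_if_upper_regular[OF \<mu> True \<open>1 \<le> p\<close> \<open>0 < \<eta>\<close> that(4,1,2)] that(3) by auto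
  next
    case False
    have "(SUP x. emeasure \<mu> (cball x 1)) < \<infinity>"
      using that \<open>\<And>r. 0 < r \<Longrightarrow> \<exists>c>0. \<forall>z. ennreal c \<le> emeasure m (ball z r)\<close>
        \<open>\<And>x. emeasure m (ball x 2) \<le> ennreal (V 2)\<close>
      by (intro SUP_emeasure_cball_finite[OF m \<mu>, where a="\<lambda>r. C * r powr \<eta>" and R=R]) auto
    then show ?thesis using False \<mu> by (simp add: class_K_def)
  qed
  have D: "p * (\<nu> - \<beta>) < \<eta>" if "0 < R" "0 < C" "?lb x R C" "\<mu> \<in> class_D \<nu> \<beta> p" for x R C
    using exponent_less_if_class_D[OF that(4) \<open>1 \<le> p\<close> \<open>0 < \<eta>\<close> that(1,2)] that(3) by blast
  note KD = subsetD[OF class_K_subset_class_D, of \<mu> \<nu> \<beta> p]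
  show ?thesis
  proof (intro conjI impI; (elim conjE exE)?)
    fix R C assume "0 < R" "0 < C" "\<forall>x. ?ub x R C" "\<eta> - p * (\<nu> - \<beta>) > 0"
    then show "\<mu> \<in> class_K \<nu> \<beta> p" using K[of R C] by auto
  next
    fix x R C assume "0 < R" "0 < C" "?lb x R C" "\<mu> \<in> class_D \<nu> \<beta> p"
    then show "\<eta> - p * (\<nu> - \<beta>) \<ge> 0" using D[of R C x] by auto
  next
    fix x R C C' assume "0 < R" "0 < C" "\<mu> \<in> class_D \<nu> \<beta> p"
      "\<forall>r. 0 < r \<and> r \<le> R \<longrightarrow> ennreal (C * r powr \<eta>) \<le> emeasure \<mu> (ball x r) \<and>
          emeasure \<mu> (ball x r) \<le> ennreal (C' * r powr \<eta>)"
    then show "\<eta> - p * (\<nu> - \<beta>) > 0" using D[of R C x] by auto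
  next
    fix R C C'
    assume "0 < R" "0 < C" "0 < C'" and
      reg: "\<forall>x r. 0 < r \<and> r \<le> R \<longrightarrow> ennreal (C * r powr \<eta>) \<le> emeasure \<mu> (ball x r) \<and>
          emeasure \<mu> (ball x r) \<le> ennreal (C' * r powr \<eta>)"
    then have K': "p * (\<nu> - \<beta>) < \<eta> \<Longrightarrow> \<mu> \<in> class_K \<nu> \<beta> p" using K[of R C'] by blast
    have D': "\<mu> \<in> class_D \<nu> \<beta> p \<Longrightarrow> p * (\<nu> - \<beta>) < \<eta>"
      using D[of R C undefined] reg \<open>0 < R\<close> \<open>0 < C\<close> by blast
    show "\<mu> \<in> class_K \<nu> \<beta> p \<longleftrightarrow> \<mu> \<in> class_D \<nu> \<beta> p" using K' D' KD by blast
    show "\<mu> \<in> class_D \<nu> \<beta> p \<longleftrightarrow> \<eta> - p * (\<nu> - \<beta>) > 0" using K' D' KD by auto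
  qed
qed

end
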